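(* Let $d\geq 1$ and let the initial resources $(C_0(x))_{x\in\mathbb{Z}^d}$, with values in $[0,\infty]$, have any translation-invariant distribution. Then for the clustering dynamics on $\mathbb{Z}^d$ the flow at each vertex almost surely stops after finitely many steps; that is, for every $x\in\mathbb{Z}^d$, $$\mathbb{P}\big(\text{there exists } N<\infty \text{ such that } a_n(x)=x \text{ for all } n\geq N\big)=1 .$$
   Context: Model. On $\mathbb{Z}^d$ (nearest-neighbor graph), write $x\sim y$ if $x,y$ are adjacent, $x\simeq y$ if $x=y$ or $x\sim y$, and $\mathcal{G}_x=\{y: y\simeq x\}$. Initially each vertex $x$ holds a random amount of resource $C_0(x)\in[0,\infty]$, and the joint law of $(C_0(x))_{x\in\mathbb{Z}^d}$ is invariant under translations of $\mathbb{Z}^d$. Given $(C_n(x))_{x\in\mathbb{Z}^d}$ at time $n=0,1,2,\dots$, each vertex $x$ chooses a vertex $a_n(x)\in\mathcal{G}_x$ as follows: if $C_n(x)=0$ then $a_n(x)=x$; if $C_n(x)>0$ then $a_n(x)$ is the vertex $y\in\mathcal{G}_x$ maximizing $C_n(y)$, and if more than one $y\in\mathcal{G}_x$ attains the maximum (a tie at $x$ at time $n$), $a_n(x)$ is chosen uniformly at random among the maximizing vertices, each such random choice being made independently of the initial resources and of all other tie-breaking choices. All vertices update simultaneously: with $E_n(y)=\{x\in\mathcal{G}_y: a_n(x)=y\}$, set $C_{n+1}(y)=\sum_{x\in E_n(y)}C_n(x)$. $\mathbb{P}$ denotes the underlying probability measure, for both the initial resources and the tie breaks. *)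

theory Defs
  imports "HOL-Probability.Probability"
begin

type_synonym 'd site = "int ^ 'd"

definition adjacent :: "'d::finite site \<Rightarrow> 'd site \<Rightarrow> bool" where
  "adjacent x y \<longleftrightarrow> (\<Sum>i\<in>UNIV. \<bar>x $ i - y $ i\<bar>) = 1"

definition nbhd :: "'d::finite site \<Rightarrow> 'd site set" where
  "nbhd x = {y. y = x \<or> adjacent x y}"

definition maximizers :: "('d::finite site \<Rightarrow> ennreal) \<Rightarrow> 'd site \<Rightarrow> 'd site set" where
  "maximizers C x = {y \<in> nbhd x. \<forall>z\<in>nbhd x. C z \<le> C y}"

text \<open>
  The argument \<open>t\<close> supplies the tie breaks of one time step: \<open>t x S\<close> is the vertex chosen
  by \<open>x\<close> if there is a tie at \<open>x\<close> and \<open>S\<close> is the set of maximizing vertices.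
\<close>

definition target ::
    "('d::finite site \<Rightarrow> 'd site set \<Rightarrow> 'd site) \<Rightarrow> ('d site \<Rightarrow> ennreal) \<Rightarrow> 'd site \<Rightarrow> 'd site" where
  "target t C x =
     (if C x = 0 then x
      else if is_singleton (maximizers C x) then the_elem (maximizers C x)
      else t x (maximizers C x))"

definition transfer :: "('d::finite site \<Rightarrow> 'd site) \<Rightarrow> ('d site \<Rightarrow> ennreal) \<Rightarrow> 'd site \<Rightarrow> ennreal" where
  "transfer a C y = (\<Sum>x\<in>{x \<in> nbhd y. a x = y}. C x)"

primrec resource ::
    "(nat \<Rightarrow> 'd::finite site \<Rightarrow> 'd site set \<Rightarrow> 'd site) \<Rightarrow> ('d site \<Rightarrow> ennreal)
      \<Rightarrow> nat \<Rightarrow> 'd site \<Rightarrow> ennreal" where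
  "resource t c 0 = c"
| "resource t c (Suc n) = transfer (target (t n) (resource t c n)) (resource t c n)"

definition flow ::
    "(nat \<Rightarrow> 'd::finite site \<Rightarrow> 'd site set \<Rightarrow> 'd site) \<Rightarrow> ('d site \<Rightarrow> ennreal)
      \<Rightarrow> nat \<Rightarrow> 'd site \<Rightarrow> 'd site" where
  "flow t c n = target (t n) (resource t c n)"

abbreviation config_space :: "('d::finite site \<Rightarrow> ennreal) measure" where
  "config_space \<equiv> PiM UNIV (\<lambda>_. borel)"

definition translation_invariant :: "'w measure \<Rightarrow> ('w \<Rightarrow> 'd::finite site \<Rightarrow> ennreal) \<Rightarrow> bool" where
  "translation_invariant M X \<longleftrightarrow>
     (\<forall>z. distr M config_space (\<lambda>\<omega> x. X \<omega> (x + z)) = distr M config_space X)"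

definition tie_index :: "(nat \<times> 'd::finite site \<times> 'd site set) set" where
  "tie_index = {(n, x, S). S \<subseteq> nbhd x \<and> card S \<ge> 2}"

text \<open>
  A tie break is provided for every time, every vertex and every potential set of maximizers;
  for each time and vertex the dynamics consults at most one of them.
  Independence of the initial resources (as one random element) and all the tie breaks is
  expressed by \<open>indep_sets\<close> for the generated \<open>\<sigma>\<close>-algebras, because \<open>indep_vars\<close> requires a
  common codomain type. The index \<open>None\<close> stands for the initial resources.
\<close>

fun source_events ::
    "'w measure \<Rightarrow> ('w \<Rightarrow> 'd::finite site \<Rightarrow> ennreal)
      \<Rightarrow> ('w \<Rightarrow> nat \<Rightarrow> 'd site \<Rightarrow> 'd site set \<Rightarrow> 'd site)
      \<Rightarrow> (nat \<times> 'd site \<times> 'd site set) option \<Rightarrow> 'w set set" where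
  "source_events M X T None = sets (vimage_algebra (space M) X config_space)"
| "source_events M X T (Some (n, x, S)) =
     sets (vimage_algebra (space M) (\<lambda>\<omega>. T \<omega> n x S) (count_space UNIV))"

definition independent_uniform_tie_breaks ::
    "'w measure \<Rightarrow> ('w \<Rightarrow> 'd::finite site \<Rightarrow> ennreal)
      \<Rightarrow> ('w \<Rightarrow> nat \<Rightarrow> 'd site \<Rightarrow> 'd site set \<Rightarrow> 'd site) \<Rightarrow> bool" where
  "independent_uniform_tie_breaks M X T \<longleftrightarrow>
     (\<forall>(n, x, S)\<in>tie_index.
        (\<lambda>\<omega>. T \<omega> n x S) \<in> M \<rightarrow>\<^sub>M count_space UNIV \<and>
        distr M (count_space UNIV) (\<lambda>\<omega>. T \<omega> n x S) = measure_pmf (pmf_of_set S)) \<and>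
     prob_space.indep_sets M (source_events M X T) (insert None (Some ` tie_index))"

lemma finite_nbhd: "finite (nbhd x)"
proof -
  let ?B = "{y. \<forall>i. y $ i \<in> {x $ i - 1..x $ i + 1}}"
  have "y \<in> ?B" if "y \<in> nbhd x" for y
  proof -
    have "\<bar>x $ i - y $ i\<bar> \<le> 1" for i
    proof (cases "y = x")
      case False
      then have "(\<Sum>i\<in>UNIV. \<bar>x $ i - y $ i\<bar>) = 1"
        using that by (simp add: nbhd_def adjacent_def)
      then show ?thesis
        using member_le_sum[of i UNIV "\<lambda>i. \<bar>x $ i - y $ i\<bar>"] by simp
    qed simp
    then show ?thesis by (auto simp: abs_le_iff algebra_simps)
  qed
  moreover have "finite ?B"
  proof (rule finite_subset)
    show "?B \<subseteq> vec_lambda ` (PiE UNIV (\<lambda>i. {x $ i - 1..x $ i + 1}))"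
    proof
      fix y assume "y \<in> ?B"
      then have "y = vec_lambda (vec_nth y)" "vec_nth y \<in> PiE UNIV (\<lambda>i. {x $ i - 1..x $ i + 1})"
        by auto
      then show "y \<in> vec_lambda ` (PiE UNIV (\<lambda>i. {x $ i - 1..x $ i + 1}))" by blast
    qed
  qed (intro finite_imageI finite_PiE, auto)
  ultimately show ?thesis by (meson finite_subset subsetI)
qed

lemma maximizers_nonempty: "maximizers C x \<noteq> {}"
proof -
  have "finite (C ` nbhd x)" "C ` nbhd x \<noteq> {}"
    using finite_nbhd[of x] by (auto simp: nbhd_def)
  then obtain y where "y \<in> nbhd x" "C y = Max (C ` nbhd x)"
    by (metis (no_types, lifting) Max_in imageE)
  then have "y \<in> maximizers C x"
    using \<open>finite (C ` nbhd x)\<close> by (auto simp: maximizers_def)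
  then show ?thesis by blast
qed

lemma tie_in_tie_index:
  "\<not> is_singleton (maximizers C x) \<Longrightarrow> (n, x, maximizers C x) \<in> tie_index"
proof -
  assume a: "\<not> is_singleton (maximizers C x)"
  have s: "maximizers C x \<subseteq> nbhd x" by (auto simp: maximizers_def)
  then have "card (maximizers C x) \<noteq> 0"
    using finite_nbhd maximizers_nonempty by (metis card_0_eq finite_subset)
  moreover have "card (maximizers C x) \<noteq> 1" using a by (simp add: is_singleton_altdef)
  ultimately show ?thesis using s by (simp add: tie_index_def)
qed

end

theory Submission
  imports Defs
begin

text \<open>
  The proof plays mass transport off against monotonicity. Write \<open>C\<close> and \<open>C'\<close> for the resource at
  two successive times, \<open>a\<close> for the choices made in between, and call a vertex a sender to \<open>y\<close>
  if it holds positive resource and chooses \<open>y\<close>.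

  \<^emph>\<open>Almost every step is a permutation.\<close> A sender to \<open>y\<close> holds at most as much as \<open>y\<close>, so emptied
  vertices stay empty, and the probability \<open>p\<close> that a vertex holds something decreases in time.
  By translation invariance the expected number of senders to a vertex equals the
  probability of being a sender, which is \<open>p\<close>. A vertex that still holds something after the step
  is one with at least one sender. Hence the probability that an occupied vertex is imbalanced, that
  is, does not have exactly one sender, is at most twice the decrease of \<open>p\<close>, and it is summable
  over time (\<open>imbalance_le\<close>).

  \<^emph>\<open>Ties disappear.\<close> If \<open>y\<close> breaks a tie in favour of \<open>u\<close>, exchanging the outcome of this one tie
  break changes the number of senders to \<open>u\<close> by one, so \<open>u\<close> is imbalanced before or after the
  exchange. The exchange preserves the law, hence ties are summable as well (\<open>summable_tied\<close>).

  \<^emph>\<open>Moving persists.\<close> By the Borel-Cantelli lemma, from some time on there are no ties and no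
  imbalances near a given vertex \<open>y\<close>. If \<open>y\<close> now moves to \<open>z\<close>, its only sender \<open>x\<close> differs from \<open>y\<close>,
  and \<open>C x < C y\<close> because \<open>x\<close> has no tie. After the step, \<open>y\<close> holds \<open>C x\<close> and \<open>z\<close> holds \<open>C y\<close>, so \<open>y\<close>
  sees a strictly richer neighbour and moves again (\<open>moving_persists\<close>). A vertex that moves
  infinitely often therefore ascends, that is, sends to a strictly richer vertex, at all
  late times, and it is enough that the probability of ascending at time \<open>n\<close> tends to \<open>0\<close>.

  \<^emph>\<open>Ascending becomes improbable.\<close> An ascending vertex \<open>x\<close> crosses every threshold \<open>c\<close> with
  \<open>C x \<le> c < C (a x)\<close>. For a single threshold, mass transport bounds the probability of a crossing by
  a multiple of the probability of imbalance, because along a chain of unique senders the vertices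
  above \<open>c\<close> are as frequent as the vertices whose choice lies above \<open>c\<close>
  (\<open>prob_crosses_level_le\<close>). So for finitely many thresholds the probability tends to \<open>0\<close>. On the
  other hand, where there is no imbalance a crossing at \<open>y\<close> is handed on to \<open>a y\<close>: the transported
  resource keeps its value, while the largest value that it sees does not decrease. By mass
  transport again, the probability of crossing a finite set of thresholds is nondecreasing in time
  up to a summable error (\<open>prob_crosses_Suc\<close>). Together, at time \<open>n\<close> it is at most the tail of the
  error series from \<open>n\<close> on. This bound does not depend on the finite set, which may therefore grow
  to a dense one: the bound holds for ascending too (\<open>prob_ascends_le_tail\<close>).
\<close>

section \<open>Resource and tie breaks as one random element\<close>

abbreviation tie_space :: "(nat \<times> 'd::finite site \<times> 'd site set \<Rightarrow> 'd site) measure" where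
  "tie_space \<equiv> PiM tie_index (\<lambda>_. count_space UNIV)"

text \<open>
  Only the tie breaks indexed by \<open>tie_index\<close> are random variables with a prescribed law, so the
  other values of \<open>t\<close> are discarded before speaking of a law.
\<close>
definition sources ::
    "('d::finite site \<Rightarrow> ennreal) \<Rightarrow> (nat \<Rightarrow> 'd site \<Rightarrow> 'd site set \<Rightarrow> 'd site) \<Rightarrow>
     ('d site \<Rightarrow> ennreal) \<times> (nat \<times> 'd site \<times> 'd site set \<Rightarrow> 'd site)" where
  "sources c t = (c, \<lambda>(n, x, S)\<in>tie_index. t n x S)"

lemma (in prob_space) indep_sets_reindex:
  assumes indep: "indep_sets F I" and inj: "inj_on r J" and r: "r ` J \<subseteq> I"
    and G: "\<And>j. j \<in> J \<Longrightarrow> G j \<subseteq> F (r j)"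
  shows "indep_sets G J"
proof (rule indep_setsI)
  show "G j \<subseteq> events" if "j \<in> J" for j
    using indep r G[OF that] that unfolding indep_sets_def by blast
next
  fix A K
  assume K: "K \<noteq> {}" "K \<subseteq> J" "finite K" and A: "\<forall>j\<in>K. A j \<in> G j"
  define B where "B = A \<circ> inv_into J r"
  have B: "B (r j) = A j" if "j \<in> K" for j
    using K(2) that inj by (auto simp: B_def)
  have "prob (\<Inter>i\<in>r ` K. B i) = (\<Prod>i\<in>r ` K. prob (B i))"
    using K A B G r by (intro indep_setsD[OF indep]) (auto simp: image_subset_iff subset_iff)
  also have "(\<Inter>i\<in>r ` K. B i) = (\<Inter>j\<in>K. A j)"
    using B by auto
  also have "(\<Prod>i\<in>r ` K. prob (B i)) = (\<Prod>j\<in>K. prob (A j))"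
    using B inj_on_subset[OF inj K(2)] by (subst prod.reindex) auto
  finally show "prob (\<Inter>j\<in>K. A j) = (\<Prod>j\<in>K. prob (A j))" .
qed

lemma tie_index_nonempty: "(tie_index :: (nat \<times> 'd::finite site \<times> 'd site set) set) \<noteq> {}"
proof -
  obtain i :: 'd where True by simp
  let ?y = "axis i 1 :: 'd site"
  have "(\<Sum>j\<in>UNIV. \<bar>(0 :: 'd site) $ j - ?y $ j\<bar>) = (\<Sum>j\<in>UNIV. if j = i then 1 else 0)"
    by (intro sum.cong) (auto simp: axis_def)
  then have "adjacent 0 ?y"
    by (simp add: adjacent_def)
  moreover have "0 \<noteq> ?y"
    by (metis axis_eq_0_iff zero_neq_one)
  ultimately have "(0, 0, {0, ?y}) \<in> tie_index"
    by (auto simp: tie_index_def nbhd_def)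
  then show ?thesis
    by blast
qed

lemma tie_index_finite:
  assumes "(n, x, S) \<in> tie_index"
  shows "finite S" "S \<noteq> {}"
  using assms finite_subset[OF _ finite_nbhd[of x]] by (auto simp: tie_index_def)

lemma source_events_Some:
  "source_events M X T (Some (n, x, S)) = {(\<lambda>\<omega>. T \<omega> n x S) -` A \<inter> space M |A. True}"
  by (simp add: sets_vimage_algebra2)

lemma source_events_None:
  "source_events M X T None = {X -` A \<inter> space M |A. A \<in> sets config_space}"
  by (simp add: sets_vimage_algebra2 space_PiM)

lemma Int_stable_source_events: "Int_stable (source_events M X T i)"
  by (cases i) (auto intro!: sets.Int_stable simp: Int_stable_def simp del: sets_vimage_algebra)

context prob_space
begin

context
  fixes X :: "'a \<Rightarrow> 'd::finite site \<Rightarrow> ennreal" and T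
  assumes X: "X \<in> M \<rightarrow>\<^sub>M config_space" and T: "independent_uniform_tie_breaks M X T"
begin

lemma measurable_tie:
  "(n, x, S) \<in> tie_index \<Longrightarrow> (\<lambda>\<omega>. T \<omega> n x S) \<in> M \<rightarrow>\<^sub>M count_space UNIV"
  using T unfolding independent_uniform_tie_breaks_def by blast

lemma distr_tie:
  "(n, x, S) \<in> tie_index \<Longrightarrow>
    distr M (count_space UNIV) (\<lambda>\<omega>. T \<omega> n x S) = measure_pmf (pmf_of_set S)"
  using T unfolding independent_uniform_tie_breaks_def by blast

lemma indep_source_events: "indep_sets (source_events M X T) (insert None (Some ` tie_index))"
  using T unfolding independent_uniform_tie_breaks_def by blast

lemma measurable_ties: "(\<lambda>\<omega>. \<lambda>(n, x, S)\<in>tie_index. T \<omega> n x S) \<in> M \<rightarrow>\<^sub>M tie_space"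
  by (rule measurable_restrict) (auto simp: measurable_tie)

lemma measurable_sources: "(\<lambda>\<omega>. sources (X \<omega>) (T \<omega>)) \<in> M \<rightarrow>\<^sub>M config_space \<Otimes>\<^sub>M tie_space"
  unfolding sources_def using X measurable_ties by measurable

lemma distr_ties:
  "distr M tie_space (\<lambda>\<omega>. \<lambda>(n, x, S)\<in>tie_index. T \<omega> n x S) =
    PiM tie_index (\<lambda>(n, x, S). measure_pmf (pmf_of_set S))"
proof -
  let ?T = "\<lambda>(n, x, S) \<omega>. T \<omega> n x S"
  have "indep_vars (\<lambda>_. count_space UNIV) ?T tie_index"
    unfolding indep_vars_def2
  proof (intro conjI ballI)
    show "indep_sets (\<lambda>i. {?T i -` A \<inter> space M |A. A \<in> sets (count_space UNIV)}) tie_index"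
      by (rule indep_sets_reindex[OF indep_source_events, where r = Some])
         (auto simp: source_events_Some simp del: source_events.simps, blast)
  qed (auto simp: measurable_tie)
  then have "distr M tie_space (\<lambda>\<omega>. \<lambda>i\<in>tie_index. ?T i \<omega>) =
      PiM tie_index (\<lambda>i. distr M (count_space UNIV) (?T i))"
    by (subst (asm) indep_vars_iff_distr_eq_PiM') (auto simp: tie_index_nonempty measurable_tie)
  also have "PiM tie_index (\<lambda>i. distr M (count_space UNIV) (?T i)) =
      PiM tie_index (\<lambda>(n, x, S). measure_pmf (pmf_of_set S))"
    by (intro PiM_cong) (auto simp: distr_tie)
  also have "(\<lambda>\<omega>. \<lambda>i\<in>tie_index. ?T i \<omega>) = (\<lambda>\<omega>. \<lambda>(n, x, S)\<in>tie_index. T \<omega> n x S)"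
    by (intro ext) (auto simp: restrict_def)
  finally show ?thesis .
qed

text \<open>
  The hypotheses on the tie breaks and the law of \<open>X\<close> together determine the joint law. Invariance of
  the dynamics under a transformation of its sources therefore follows as soon as the transformed
  sources satisfy the same hypotheses.
\<close>
lemma distr_sources:
  "distr M (config_space \<Otimes>\<^sub>M tie_space) (\<lambda>\<omega>. sources (X \<omega>) (T \<omega>)) =
    distr M config_space X \<Otimes>\<^sub>M PiM tie_index (\<lambda>(n, x, S). measure_pmf (pmf_of_set S))"
proof -
  let ?N = "config_space \<Otimes>\<^sub>M tie_space :: (('d site \<Rightarrow> ennreal) \<times> _) measure"
  let ?ties = "\<lambda>\<omega>. \<lambda>(n, x, S)\<in>tie_index. T \<omega> n x S"
  \<comment> \<open>Group the independent sources into the initial resources and all tie breaks.\<close>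
  let ?I = "\<lambda>b. if b then {None} else Some ` tie_index :: (nat \<times> 'd site \<times> 'd site set) option set"
  let ?\<Sigma> = "\<lambda>b. sigma_sets (space M) (\<Union>i\<in>?I b. source_events M X T i)"
  have "(\<Union>b. ?I b) = insert None (Some ` tie_index)"
    by (auto simp: UNIV_bool)
  then have indep: "indep_sets ?\<Sigma> UNIV"
    using indep_source_events
    by (intro indep_sets_collect_sigma)
       (auto simp: Int_stable_source_events disjoint_family_on_def simp del: source_events.simps)
  have X_event: "X -` A \<inter> space M \<in> ?\<Sigma> True" if "A \<in> sets config_space" for A
    using that by (auto simp: source_events_None simp del: source_events.simps intro: sigma_sets.Basic)
  have ties_event: "?ties -` B \<inter> space M \<in> ?\<Sigma> False" if "B \<in> sets tie_space" for B
  proof -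
    let ?G = "\<Union>i\<in>?I False. source_events M X T i"
    have "?G \<subseteq> Pow (space M)"
      by (auto simp: source_events_Some simp del: source_events.simps)
    then have sets: "sets (sigma (space M) ?G) = ?\<Sigma> False" "space (sigma (space M) ?G) = space M"
      by simp_all
    have "?ties \<in> sigma (space M) ?G \<rightarrow>\<^sub>M tie_space"
    proof (rule measurable_restrict)
      fix i :: "nat \<times> 'd site \<times> 'd site set"
      assume i: "i \<in> tie_index"
      obtain n x S where [simp]: "i = (n, x, S)" by (cases i)
      have "(\<lambda>\<omega>. T \<omega> n x S) -` A \<inter> space M \<in> ?G" for A
      proof (rule UN_I[of "Some i"])
        show "(\<lambda>\<omega>. T \<omega> n x S) -` A \<inter> space M \<in> source_events M X T (Some i)"
          unfolding \<open>i = (n, x, S)\<close> source_events_Some by blast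
      qed (use i in simp)
      then show "(\<lambda>\<omega>. case i of (n, x, S) \<Rightarrow> T \<omega> n x S) \<in> sigma (space M) ?G \<rightarrow>\<^sub>M count_space UNIV"
        unfolding measurable_def sets by (auto intro: sigma_sets.Basic)
    qed
    from measurable_sets[OF this that] show ?thesis
      unfolding sets .
  qed
  have "distr M config_space X \<Otimes>\<^sub>M distr M tie_space ?ties =
      distr M ?N (\<lambda>\<omega>. sources (X \<omega>) (T \<omega>))"
  proof (rule pair_measure_eqI)
    show "sigma_finite_measure (distr M config_space X)"
      by (intro prob_space_imp_sigma_finite prob_space_distr X)
    show "sigma_finite_measure (distr M tie_space ?ties)"
      by (intro prob_space_imp_sigma_finite prob_space_distr measurable_ties)
    fix A B assume "A \<in> sets (distr M config_space X)" "B \<in> sets (distr M tie_space ?ties)"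
    then have A: "A \<in> sets config_space" and B: "B \<in> sets tie_space" by auto
    have "(\<lambda>\<omega>. sources (X \<omega>) (T \<omega>)) -` (A \<times> B) \<inter> space M =
        (X -` A \<inter> space M) \<inter> (?ties -` B \<inter> space M)"
      by (auto simp: sources_def)
    moreover have "prob ((X -` A \<inter> space M) \<inter> (?ties -` B \<inter> space M)) =
        prob (X -` A \<inter> space M) * prob (?ties -` B \<inter> space M)"
      using indep_setsD[OF indep, of UNIV
          "\<lambda>b. if b then X -` A \<inter> space M else ?ties -` B \<inter> space M"] X_event[OF A] ties_event[OF B]
      by (simp add: UNIV_bool mult.commute Int_commute)
    ultimately show "emeasure (distr M config_space X) A * emeasure (distr M tie_space ?ties) B =
        emeasure (distr M ?N (\<lambda>\<omega>. sources (X \<omega>) (T \<omega>))) (A \<times> B)"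
      using A B measurable_sources X measurable_ties
      by (simp add: emeasure_distr emeasure_eq_measure ennreal_mult'')
  qed simp
  then show ?thesis
    by (simp add: distr_ties)
qed

text \<open>
  The two transformations of interest are translations, where \<open>r\<close> moves the index and \<open>f\<close> moves the
  chosen vertex back, and the exchange of two outcomes of a single tie break, where \<open>r\<close> is
  the identity and \<open>f\<close> is a transposition.
\<close>
lemma independent_uniform_tie_breaks_transform:
  fixes r :: "nat \<times> 'd site \<times> 'd site set \<Rightarrow> nat \<times> 'd site \<times> 'd site set"
  assumes h: "h \<in> config_space \<rightarrow>\<^sub>M config_space"
    and r: "inj_on r tie_index" "r ` tie_index \<subseteq> tie_index"
    and f: "\<And>i. i \<in> tie_index \<Longrightarrow> bij_betw (f i) (snd (snd (r i))) (snd (snd i))"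
    and T': "\<And>\<omega> n x S. (n, x, S) \<in> tie_index \<Longrightarrow>
      T' \<omega> n x S = f (n, x, S) (case r (n, x, S) of (m, y, R) \<Rightarrow> T \<omega> m y R)"
  shows "independent_uniform_tie_breaks M (\<lambda>\<omega>. h (X \<omega>)) T'"
  unfolding independent_uniform_tie_breaks_def
proof (intro conjI ballI)
  fix i :: "nat \<times> 'd site \<times> 'd site set" assume i: "i \<in> tie_index"
  obtain n x S where i_eq: "i = (n, x, S)" by (cases i)
  obtain m y R where r_eq: "r i = (m, y, R)" by (cases "r i")
  have ri: "(m, y, R) \<in> tie_index"
    using r(2) i r_eq by fastforce
  have eq: "(\<lambda>\<omega>. T' \<omega> n x S) = (\<lambda>\<omega>. f i (T \<omega> m y R))"
    using T' i i_eq r_eq by auto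
  have "bij_betw (f i) R S"
    using f[OF i] r_eq by (simp add: i_eq)
  then have "map_pmf (f i) (pmf_of_set R) = pmf_of_set S"
    using tie_index_finite[OF ri] by (intro map_pmf_of_set_bij_betw)
  moreover have "distr M (count_space UNIV) (\<lambda>\<omega>. f i (T \<omega> m y R)) =
      distr (distr M (count_space UNIV) (\<lambda>\<omega>. T \<omega> m y R)) (count_space UNIV) (f i)"
    using measurable_tie[OF ri] by (subst distr_distr) (auto simp: comp_def)
  ultimately have "distr M (count_space UNIV) (\<lambda>\<omega>. T' \<omega> n x S) = measure_pmf (pmf_of_set S)"
    using distr_tie[OF ri] by (simp add: eq map_pmf_rep_eq[symmetric])
  moreover have "(\<lambda>\<omega>. T' \<omega> n x S) \<in> M \<rightarrow>\<^sub>M count_space UNIV"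
    unfolding eq using measurable_tie[OF ri] by (auto intro: measurable_compose)
  ultimately show "case i of (n, x, S) \<Rightarrow> (\<lambda>\<omega>. T' \<omega> n x S) \<in> M \<rightarrow>\<^sub>M count_space UNIV \<and>
      distr M (count_space UNIV) (\<lambda>\<omega>. T' \<omega> n x S) = measure_pmf (pmf_of_set S)"
    by (simp add: i_eq)
next
  show "indep_sets (source_events M (\<lambda>\<omega>. h (X \<omega>)) T') (insert None (Some ` tie_index))"
  proof (rule indep_sets_reindex[OF indep_source_events, where r = "map_option r"])
    show "inj_on (map_option r) (insert None (Some ` tie_index))"
      using r(1) by (auto simp: inj_on_def)
    show "map_option r ` insert None (Some ` tie_index) \<subseteq> insert None (Some ` tie_index)"
      using r(2) by auto
    fix j assume "j \<in> insert None (Some ` (tie_index :: (nat \<times> 'd site \<times> 'd site set) set))"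
    then consider "j = None" | n x S where "j = Some (n, x, S)" "(n, x, S) \<in> tie_index"
      by auto
    then show "source_events M (\<lambda>\<omega>. h (X \<omega>)) T' j \<subseteq> source_events M X T (map_option r j)"
    proof cases
      case 1
      have "(\<lambda>\<omega>. h (X \<omega>)) -` A \<inter> space M = X -` (h -` A) \<inter> space M" for A
        by auto
      moreover have "h -` A \<in> sets config_space" if "A \<in> sets config_space" for A
        using measurable_sets[OF h that] by (simp add: space_PiM)
      ultimately show ?thesis
        unfolding 1 option.map source_events_None by blast
    next
      case 2
      obtain m y R where r_eq: "r (n, x, S) = (m, y, R)" by (cases "r (n, x, S)")
      have "(\<lambda>\<omega>. T' \<omega> n x S) -` A \<inter> space M =
          (\<lambda>\<omega>. T \<omega> m y R) -` (f (n, x, S) -` A) \<inter> space M" for A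
        using T'[OF 2(2)] r_eq by auto
      then show ?thesis
        unfolding 2(1) by (auto simp: r_eq source_events_Some simp del: source_events.simps)
    qed
  qed
qed

lemma AE_tie_in: "AE \<omega> in M. \<forall>(n, x, S)\<in>tie_index. T \<omega> n x S \<in> S"
proof -
  let ?I = "tie_index :: (nat \<times> 'd site \<times> 'd site set) set"
  have "?I \<subseteq> UNIV \<times> UNIV \<times> {S. finite S}"
    using tie_index_finite by auto
  moreover have "countable (UNIV \<times> UNIV \<times> {S. finite S} :: (nat \<times> 'd site \<times> 'd site set) set)"
    by (intro countable_SIGMA countable_Collect_finite) auto
  ultimately have "countable ?I"
    by (rule countable_subset)
  moreover have "AE \<omega> in M. T \<omega> n x S \<in> S" if i: "(n, x, S) \<in> ?I" for n x S
  proof -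
    have "AE y in measure_pmf (pmf_of_set S). y \<in> S"
      using tie_index_finite[OF i] by (auto simp: AE_measure_pmf_iff)
    then show ?thesis
      unfolding distr_tie[OF i, symmetric] by (subst (asm) AE_distr_iff) (auto intro: measurable_tie[OF i])
  qed
  ultimately have "AE \<omega> in M. \<forall>i\<in>?I. (case i of (n, x, S) \<Rightarrow> T \<omega> n x S \<in> S)"
    by (subst AE_ball_countable) auto
  then show ?thesis .
qed

end

end

section \<open>One step of the dynamics\<close>

lemma nbhd_commute: "y \<in> nbhd x \<longleftrightarrow> x \<in> nbhd y"
  by (auto simp: nbhd_def adjacent_def abs_minus_commute)

lemma self_in_nbhd [simp]: "x \<in> nbhd x"
  by (simp add: nbhd_def)

lemma nbhd_translate: "nbhd (x + z) = (\<lambda>y. y + z) ` nbhd x"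
proof
  have *: "y + z \<in> nbhd (x + z) \<longleftrightarrow> y \<in> nbhd x" for y
    by (auto simp: nbhd_def adjacent_def)
  show "(\<lambda>y. y + z) ` nbhd x \<subseteq> nbhd (x + z)"
    using * by blast
  show "nbhd (x + z) \<subseteq> (\<lambda>y. y + z) ` nbhd x"
  proof
    fix w assume "w \<in> nbhd (x + z)"
    then have "w - z \<in> nbhd x"
      using *[of "w - z"] by simp
    then show "w \<in> (\<lambda>y. y + z) ` nbhd x"
      by (rule rev_image_eqI) simp
  qed
qed

lemma nbhd_reflect: "x + x - y \<in> nbhd x \<longleftrightarrow> y \<in> nbhd x"
proof -
  have "x - (x + x - y) = y - x"
    by simp
  then have "x $ i - (x + x - y) $ i = y $ i - x $ i" for i
    by (metis vector_minus_component)
  moreover have "x + x - y = x \<longleftrightarrow> y = x"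
    by (metis add_diff_cancel_left' add_diff_cancel_right' diff_add_cancel)
  ultimately show ?thesis
    by (simp add: nbhd_def adjacent_def abs_minus_commute)
qed

text \<open>
  A vertex without resource chooses itself in the dynamics; it is excluded here, so that counting
  senders counts flows of positive resource.
\<close>
definition senders ::
    "('d::finite site \<Rightarrow> ennreal) \<Rightarrow> ('d site \<Rightarrow> 'd site) \<Rightarrow> 'd site \<Rightarrow> 'd site set" where
  "senders C a y = {x \<in> nbhd y. a x = y \<and> C x > 0}"

definition imbalanced ::
    "('d::finite site \<Rightarrow> ennreal) \<Rightarrow> ('d site \<Rightarrow> 'd site) \<Rightarrow> 'd site \<Rightarrow> bool" where
  "imbalanced C a y \<longleftrightarrow> C y > 0 \<and> card (senders C a y) \<noteq> 1"

definition tied :: "('d::finite site \<Rightarrow> ennreal) \<Rightarrow> 'd site \<Rightarrow> bool" where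
  "tied C x \<longleftrightarrow> C x > 0 \<and> \<not> is_singleton (maximizers C x)"

text \<open>
  What the deterministic arguments use about the choices \<open>a\<close>: how a tie is broken among the
  maximizers is left open.
\<close>
definition admissible :: "('d::finite site \<Rightarrow> ennreal) \<Rightarrow> ('d site \<Rightarrow> 'd site) \<Rightarrow> bool" where
  "admissible C a \<longleftrightarrow> (\<forall>x. (C x = 0 \<longrightarrow> a x = x) \<and> (C x > 0 \<longrightarrow> a x \<in> maximizers C x))"

lemma finite_senders: "finite (senders C a y)"
  by (simp add: senders_def finite_nbhd)

lemma admissible_maximal:
  assumes "admissible C a" "y \<in> nbhd x"
  shows "C y \<le> C (a x) \<or> C x = 0"
  using assms by (auto simp: admissible_def maximizers_def zero_less_iff_neq_zero)

lemma admissible_le: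
  assumes "admissible C a"
  shows "C x \<le> C (a x)"
  using admissible_maximal[OF assms, of x x] by auto

lemma admissible_in_nbhd:
  assumes "admissible C a"
  shows "a x \<in> nbhd x"
  using assms by (cases "C x = 0") (auto simp: admissible_def maximizers_def zero_less_iff_neq_zero)

lemma transfer_senders: "transfer a C y = (\<Sum>x\<in>senders C a y. C x)"
  unfolding transfer_def senders_def
  by (rule sum.mono_neutral_right) (auto simp: finite_nbhd zero_less_iff_neq_zero)

lemma transfer_pos_iff: "transfer a C y > 0 \<longleftrightarrow> senders C a y \<noteq> {}"
proof -
  have "transfer a C y = 0 \<longleftrightarrow> (\<forall>x\<in>senders C a y. C x = 0)"
    by (simp add: transfer_senders sum_eq_0_iff finite_senders)
  also have "\<dots> \<longleftrightarrow> senders C a y = {}"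
    unfolding senders_def by fastforce
  finally show ?thesis
    by (simp add: zero_less_iff_neq_zero)
qed

text \<open>
  A sender holds something and chooses a vertex at least as rich as itself. Consequently emptied
  vertices stay empty.
\<close>
lemma senders_pos:
  assumes "admissible C a" "x \<in> senders C a y"
  shows "C y > 0"
  using assms admissible_le[OF assms(1), of x] by (auto simp: senders_def intro: less_le_trans)

lemma target_in_senders:
  assumes "admissible C a" "C x > 0"
  shows "x \<in> senders C a (a x)"
  using assms admissible_in_nbhd[OF assms(1), of x] by (simp add: senders_def nbhd_commute)

lemma balanced_sender:
  assumes "admissible C a" "\<not> imbalanced C a y" "x \<in> senders C a y"
  shows "senders C a y = {x}" "transfer a C y = C x"
proof -
  have "card (senders C a y) = 1"
    using senders_pos[OF assms(1,3)] assms(2) by (simp add: imbalanced_def)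
  then show "senders C a y = {x}"
    using assms(3) by (auto simp: card_1_singleton_iff)
  then show "transfer a C y = C x"
    by (simp add: transfer_senders)
qed

text \<open>
  Without imbalance at \<open>y\<close> and at \<open>a y\<close>, resource is only relabelled: \<open>y\<close> takes over the value of its
  sender, and \<open>a y\<close> takes over the value of \<open>y\<close>. So the resource that has arrived at \<open>y\<close> still has a
  neighbour with the value \<open>C y\<close> that it was attracted by.
\<close>
lemma balanced_step:
  assumes adm: "admissible C a" "admissible (transfer a C) a'"
    and x: "x \<in> senders C a y"
    and bal: "\<not> imbalanced C a y" "\<not> imbalanced C a (a y)"
  shows "transfer a C y = C x" "C y \<le> transfer a C (a' y)"
proof -
  show y: "transfer a C y = C x"
    by (rule balanced_sender) (use assms in auto)
  have "C y > 0"
    using senders_pos[OF adm(1) x] .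
  then have "transfer a C (a y) = C y"
    using adm bal target_in_senders by (intro balanced_sender) auto
  moreover have "transfer a C (a y) \<le> transfer a C (a' y)"
    using admissible_maximal[OF adm(2) admissible_in_nbhd[OF adm(1), of y]] x
    by (auto simp: y senders_def)
  ultimately show "C y \<le> transfer a C (a' y)"
    by simp
qed

text \<open>
  If \<open>y\<close> moves, its unique sender \<open>x\<close> is another vertex and, having no tie, is strictly poorer
  than \<open>y\<close>. The values shift by one place along \<open>x\<close>, \<open>y\<close>, \<open>a y\<close>, which leaves \<open>y\<close> strictly poorer
  than \<open>a y\<close>.
\<close>
lemma moving_persists:
  assumes adm: "admissible C a" "admissible (transfer a C) a'"
    and bal: "\<And>u. u \<in> nbhd y \<Longrightarrow> \<not> imbalanced C a u \<and> \<not> tied C u"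
    and move: "a y \<noteq> y"
  shows "0 < transfer a C y" "transfer a C y < transfer a C (a' y)"
proof -
  have y: "C y > 0"
    using adm move by (auto simp: admissible_def zero_less_iff_neq_zero)
  then have "card (senders C a y) = 1"
    using bal[of y] by (simp add: imbalanced_def)
  then obtain x where x: "x \<in> senders C a y"
    by (auto simp: card_1_singleton_iff)
  then have ax: "a x = y" "C x > 0" "x \<in> nbhd y"
    by (auto simp: senders_def)
  have "x \<noteq> y"
    using ax move by auto
  have "y \<in> maximizers C x"
    using adm(1) ax by (auto simp: admissible_def)
  moreover have "is_singleton (maximizers C x)"
    using bal[OF ax(3)] ax(2) by (simp add: tied_def)
  ultimately have "x \<notin> maximizers C x"
    using \<open>x \<noteq> y\<close> by (auto simp: is_singleton_def)
  then have "C x < C y"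
    using \<open>y \<in> maximizers C x\<close> by (auto simp: maximizers_def not_le intro: less_le_trans)
  moreover have "transfer a C y = C x" "C y \<le> transfer a C (a' y)"
    using balanced_step[OF adm x] bal admissible_in_nbhd[OF adm(1), of y] by auto
  ultimately show "0 < transfer a C y" "transfer a C y < transfer a C (a' y)"
    using ax by auto
qed

text \<open>
  The numbers of senders to \<open>a y\<close> under the two choice functions differ by one, so they are not both \<open>1\<close>.
\<close>
lemma imbalanced_if_redirected:
  assumes adm: "admissible C a" and y: "C y > 0"
    and others: "\<And>x. x \<noteq> y \<Longrightarrow> a' x = a x" and redirect: "a' y \<noteq> a y"
  shows "imbalanced C a (a y) \<or> imbalanced C a' (a y)"
proof -
  have "y \<in> senders C a (a y)"
    by (rule target_in_senders[OF adm y])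
  moreover have "x \<in> senders C a' (a y) \<longleftrightarrow> x \<in> senders C a (a y) \<and> x \<noteq> y" for x
    using others[of x] redirect by (cases "x = y") (auto simp: senders_def)
  ultimately have "senders C a (a y) = insert y (senders C a' (a y))" "y \<notin> senders C a' (a y)"
    by blast+
  then have "card (senders C a (a y)) = Suc (card (senders C a' (a y)))"
    by (simp add: finite_senders)
  moreover have "C (a y) > 0"
    using y admissible_le[OF adm, of y] by (rule less_le_trans)
  ultimately show ?thesis
    by (auto simp: imbalanced_def)
qed

section \<open>The evolution in time and its translation\<close>

lemma admissible_flow:
  assumes "\<forall>(n, x, S)\<in>tie_index. t n x S \<in> S"
  shows "admissible (resource t c n) (flow t c n)"
  unfolding admissible_def
proof (intro allI conjI impI)
  fix x :: "'a site"
  let ?S = "maximizers (resource t c n) x"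
  show "flow t c n x = x" if "resource t c n x = 0"
    using that by (simp add: flow_def target_def)
  show "flow t c n x \<in> ?S" if pos: "resource t c n x > 0"
  proof (cases "is_singleton ?S")
    case True
    have "flow t c n x = the_elem ?S"
      using pos True by (simp add: flow_def target_def zero_less_iff_neq_zero)
    then show ?thesis
      using True by (metis is_singleton_the_elem singletonI)
  next
    case False
    have "flow t c n x = t n x ?S"
      using pos False by (simp add: flow_def target_def zero_less_iff_neq_zero)
    moreover have "t n x ?S \<in> ?S"
      using assms tie_in_tie_index[OF False, of n] by fast
    ultimately show ?thesis
      by simp
  qed
qed

lemma resource_Suc_flow: "resource t c (Suc n) = transfer (flow t c n) (resource t c n)"
  by (simp add: flow_def)

lemma flow_tied:
  "tied (resource t c n) x \<Longrightarrow> flow t c n x = t n x (maximizers (resource t c n) x)"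
  by (auto simp: flow_def target_def tied_def)

lemma target_cong:
  assumes "tied C x \<Longrightarrow> t x (maximizers C x) = t' x (maximizers C x)"
  shows "target t C x = target t' C x"
  using assms by (auto simp: target_def tied_def zero_less_iff_neq_zero)

lemma tied_in_tie_index: "tied C x \<Longrightarrow> (n, x, maximizers C x) \<in> tie_index"
  by (simp add: tied_def tie_in_tie_index)

lemma resource_cong:
  assumes "\<And>m x S. m < n \<Longrightarrow> (m, x, S) \<in> tie_index \<Longrightarrow> t m x S = t' m x S"
  shows "resource t c n = resource t' c n"
  using assms
proof (induction n)
  case (Suc n)
  have "target (t n) C = target (t' n) C" for C
    by (rule ext, rule target_cong, rule Suc.prems) (simp_all add: tied_in_tie_index)
  moreover have "resource t c n = resource t' c n"
    by (rule Suc.IH, rule Suc.prems) simp_all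
  ultimately show ?case
    by (simp only: resource.simps)
qed simp

lemma flow_cong:
  assumes "\<And>m x S. (m, x, S) \<in> tie_index \<Longrightarrow> t m x S = t' m x S"
  shows "flow t c n = flow t' c n"
proof -
  have "resource t c n = resource t' c n"
    by (rule resource_cong, rule assms)
  moreover have "target (t n) C = target (t' n) C" for C
    by (rule ext, rule target_cong, rule assms, rule tied_in_tie_index)
  ultimately show ?thesis
    by (simp only: flow_def)
qed

definition translate_ties ::
    "'d::finite site \<Rightarrow> (nat \<Rightarrow> 'd site \<Rightarrow> 'd site set \<Rightarrow> 'd site) \<Rightarrow>
     nat \<Rightarrow> 'd site \<Rightarrow> 'd site set \<Rightarrow> 'd site" where
  "translate_ties z t n x S = t n (x + z) ((\<lambda>y. y + z) ` S) - z"

lemma maximizers_translate: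
  "maximizers C (x + z) = (\<lambda>y. y + z) ` maximizers (\<lambda>x. C (x + z)) x"
  unfolding maximizers_def nbhd_translate by blast

lemma is_singleton_translate: "is_singleton ((\<lambda>y. y + z) ` S) \<longleftrightarrow> is_singleton (S :: 'd::finite site set)"
  by (simp add: is_singleton_altdef card_image)

lemma target_translate:
  "target (\<lambda>x S. t (x + z) ((\<lambda>y. y + z) ` S) - z) (\<lambda>x. C (x + z)) x = target t C (x + z) - z"
proof -
  define S where "S = maximizers (\<lambda>x. C (x + z)) x"
  have "the_elem ((\<lambda>y. y + z) ` S) = the_elem S + z" if "is_singleton S"
    using that by (auto simp: is_singleton_def)
  moreover have "maximizers C (x + z) = (\<lambda>y. y + z) ` S"
    unfolding S_def by (rule maximizers_translate)
  ultimately show ?thesis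
    by (simp add: target_def is_singleton_translate S_def[symmetric])
qed

lemma transfer_translate:
  "transfer (\<lambda>x. a (x + z) - z) (\<lambda>x. C (x + z)) y = transfer a C (y + z)"
proof -
  have "{x \<in> nbhd (y + z). a x = y + z} = (\<lambda>x. x + z) ` {x \<in> nbhd y. a (x + z) - z = y}"
    unfolding nbhd_translate by (auto simp: diff_eq_eq)
  then show ?thesis
    by (simp add: transfer_def sum.reindex)
qed

lemma target_translate_ties:
  "target (translate_ties z t n) (\<lambda>x. C (x + z)) = (\<lambda>x. target (t n) C (x + z) - z)"
  unfolding translate_ties_def by (rule ext, rule target_translate)

lemma resource_translate:
  "resource (translate_ties z t) (\<lambda>x. c (x + z)) n = (\<lambda>x. resource t c n (x + z))"
proof (induction n)
  case (Suc n)
  show ?case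
    unfolding resource.simps Suc.IH target_translate_ties by (rule ext, rule transfer_translate)
qed simp

lemma flow_translate:
  "flow (translate_ties z t) (\<lambda>x. c (x + z)) n = (\<lambda>x. flow t c n (x + z) - z)"
  unfolding flow_def resource_translate target_translate_ties by (rule refl)

section \<open>Measurability\<close>

context
  fixes M :: "'w measure" and C :: "'w \<Rightarrow> 'd::finite site \<Rightarrow> ennreal"
  assumes C [measurable]: "\<And>x. (\<lambda>\<omega>. C \<omega> x) \<in> borel_measurable M"
begin

lemma pred_maximizers_eq [measurable]: "Measurable.pred M (\<lambda>\<omega>. maximizers (C \<omega>) x = S)"
proof -
  have eq: "maximizers (C \<omega>) x = S \<longleftrightarrow>
      S \<subseteq> nbhd x \<and> (\<forall>y\<in>nbhd x. y \<in> S \<longleftrightarrow> (\<forall>z\<in>nbhd x. C \<omega> z \<le> C \<omega> y))" for \<omega>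
    by (auto simp: maximizers_def)
  show ?thesis
    unfolding eq by measurable
qed

lemma pred_maximizers: "Measurable.pred M (\<lambda>\<omega>. P (maximizers (C \<omega>) x))"
proof -
  have eq: "P (maximizers (C \<omega>) x) \<longleftrightarrow> (\<exists>S\<in>Pow (nbhd x). maximizers (C \<omega>) x = S \<and> P S)" for \<omega>
    by (auto simp: maximizers_def)
  show ?thesis
    unfolding eq by (intro pred_intros_finite pred_intros_logic pred_maximizers_eq) (simp_all add: finite_nbhd)
qed

lemma pred_tied [measurable]: "Measurable.pred M (\<lambda>\<omega>. tied (C \<omega>) x)"
  unfolding tied_def using pred_maximizers[of "\<lambda>S. \<not> is_singleton S"] by measurable

lemma measurable_target:
  assumes t: "\<And>S. \<not> is_singleton S \<Longrightarrow> S \<noteq> {} \<Longrightarrow> S \<subseteq> nbhd x \<Longrightarrow>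
      (\<lambda>\<omega>. t \<omega> x S) \<in> M \<rightarrow>\<^sub>M count_space UNIV"
  shows "(\<lambda>\<omega>. target (t \<omega>) (C \<omega>) x) \<in> M \<rightarrow>\<^sub>M count_space UNIV"
proof (rule measurable_count_space_eq2_countable[THEN iffD2], safe)
  fix y
  have eq: "target (t \<omega>) (C \<omega>) x = y \<longleftrightarrow> (C \<omega> x = 0 \<and> x = y) \<or> (C \<omega> x \<noteq> 0 \<and>
      (\<exists>S\<in>Pow (nbhd x). maximizers (C \<omega>) x = S \<and>
        (if is_singleton S then the_elem S = y else S \<noteq> {} \<and> t \<omega> x S = y)))" for \<omega>
    using maximizers_nonempty[of "C \<omega>" x] by (auto simp: target_def) (auto simp: maximizers_def)
  have "Measurable.pred M (\<lambda>\<omega>. if is_singleton S then the_elem S = y else S \<noteq> {} \<and> t \<omega> x S = y)"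
    if "S \<in> Pow (nbhd x)" for S
  proof (cases "is_singleton S \<or> S = {}")
    case False
    then have [measurable]: "(\<lambda>\<omega>. t \<omega> x S) \<in> M \<rightarrow>\<^sub>M count_space UNIV"
      using that t by auto
    show ?thesis by measurable
  qed auto
  then have "Measurable.pred M (\<lambda>\<omega>. target (t \<omega>) (C \<omega>) x = y)"
    unfolding eq by (intro pred_intros_logic pred_intros_finite(4)) (auto simp: finite_nbhd)
  then show "(\<lambda>\<omega>. target (t \<omega>) (C \<omega>) x) -` {y} \<inter> space M \<in> sets M"
    by (simp add: pred_def vimage_def Int_def conj_commute)
qed auto

context
  fixes a :: "'w \<Rightarrow> 'd site \<Rightarrow> 'd site"
  assumes a [measurable]: "\<And>x. (\<lambda>\<omega>. a \<omega> x) \<in> M \<rightarrow>\<^sub>M count_space UNIV"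
begin

lemma measurable_transfer: "(\<lambda>\<omega>. transfer (a \<omega>) (C \<omega>) y) \<in> borel_measurable M"
proof -
  have eq: "transfer (a \<omega>) (C \<omega>) y = (\<Sum>x\<in>nbhd y. if a \<omega> x = y then C \<omega> x else 0)" for \<omega>
    by (simp add: transfer_def sum.inter_filter finite_nbhd)
  show ?thesis
    unfolding eq by measurable
qed

lemma measurable_comp_target: "(\<lambda>\<omega>. C \<omega> (a \<omega> x)) \<in> borel_measurable M"
  by (rule measurable_compose_countable'[where f = "\<lambda>y \<omega>. C \<omega> y" and I = UNIV]) auto

lemma pred_senders [measurable]: "Measurable.pred M (\<lambda>\<omega>. x \<in> senders (C \<omega>) (a \<omega>) y)"
  unfolding senders_def by simp

lemma measurable_card_senders [measurable]:
  "(\<lambda>\<omega>. card (senders (C \<omega>) (a \<omega>) y)) \<in> M \<rightarrow>\<^sub>M count_space UNIV"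
proof -
  have eq: "card (senders (C \<omega>) (a \<omega>) y) =
      (\<Sum>x\<in>nbhd y. if x \<in> senders (C \<omega>) (a \<omega>) y then 1 else 0)" for \<omega>
    by (subst sum.inter_filter[symmetric])
       (auto simp: finite_nbhd senders_def intro!: arg_cong[where f = card])
  show ?thesis
    unfolding eq by measurable
qed

lemma pred_imbalanced [measurable]: "Measurable.pred M (\<lambda>\<omega>. imbalanced (C \<omega>) (a \<omega>) y)"
  unfolding imbalanced_def by measurable

end

end

lemma measurable_resource_flow:
  fixes t :: "'w \<Rightarrow> nat \<Rightarrow> 'd::finite site \<Rightarrow> 'd site set \<Rightarrow> 'd site"
  assumes c: "\<And>x. (\<lambda>\<omega>. c \<omega> x) \<in> borel_measurable M"
    and t: "\<And>n x S. (n, x, S) \<in> tie_index \<Longrightarrow> (\<lambda>\<omega>. t \<omega> n x S) \<in> M \<rightarrow>\<^sub>M count_space UNIV"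
  shows measurable_resource: "(\<lambda>\<omega>. resource (t \<omega>) (c \<omega>) n x) \<in> borel_measurable M"
    and measurable_flow: "(\<lambda>\<omega>. flow (t \<omega>) (c \<omega>) n x) \<in> M \<rightarrow>\<^sub>M count_space UNIV"
proof -
  have tie: "(n, x, S) \<in> tie_index" if "\<not> is_singleton S" "S \<noteq> {}" "S \<subseteq> nbhd x" for n x S
  proof -
    have "card S \<noteq> 0"
      using that finite_subset[OF that(3) finite_nbhd] by simp
    then show ?thesis
      using that by (simp add: tie_index_def is_singleton_altdef)
  qed
  have flow: "(\<lambda>\<omega>. flow (t \<omega>) (c \<omega>) n x) \<in> M \<rightarrow>\<^sub>M count_space UNIV"
    if "\<And>x. (\<lambda>\<omega>. resource (t \<omega>) (c \<omega>) n x) \<in> borel_measurable M" for n x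
    unfolding flow_def using that by (intro measurable_target t tie)
  have resource: "(\<lambda>\<omega>. resource (t \<omega>) (c \<omega>) n x) \<in> borel_measurable M" for n x
  proof (induction n arbitrary: x)
    case (Suc n)
    show ?case
      unfolding resource_Suc_flow by (intro measurable_transfer Suc flow)
  qed (simp add: c)
  show "(\<lambda>\<omega>. resource (t \<omega>) (c \<omega>) n x) \<in> borel_measurable M"
    by (rule resource)
  show "(\<lambda>\<omega>. flow (t \<omega>) (c \<omega>) n x) \<in> M \<rightarrow>\<^sub>M count_space UNIV"
    by (rule flow[OF resource])
qed

section \<open>The law of the state at a fixed time\<close>

abbreviation state_space :: "(('d::finite site \<Rightarrow> ennreal) \<times> ('d site \<Rightarrow> 'd site)) measure" where
  "state_space \<equiv> config_space \<Otimes>\<^sub>M PiM UNIV (\<lambda>_. count_space UNIV)"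

lemma space_state_space: "space state_space = UNIV"
  by (simp add: space_pair_measure space_PiM)

lemma measurable_state [measurable]:
  "(\<lambda>s. fst s x) \<in> borel_measurable state_space"
  "(\<lambda>s. snd s x) \<in> state_space \<rightarrow>\<^sub>M count_space UNIV"
  by measurable

lemma measurable_config_component:
  "X \<in> M \<rightarrow>\<^sub>M config_space \<Longrightarrow> (\<lambda>\<omega>. X \<omega> x) \<in> borel_measurable M"
  by (rule measurable_compose[OF _ measurable_component_singleton[of x UNIV "\<lambda>_. borel"]]) simp_all

lemma measurable_to_state:
  assumes "\<And>x. (\<lambda>\<omega>. C \<omega> x) \<in> borel_measurable M"
    and "\<And>x. (\<lambda>\<omega>. a \<omega> x) \<in> M \<rightarrow>\<^sub>M count_space UNIV"
  shows "(\<lambda>\<omega>. (C \<omega>, a \<omega>)) \<in> M \<rightarrow>\<^sub>M state_space"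
proof (rule measurable_Pair)
  show "C \<in> M \<rightarrow>\<^sub>M config_space"
    by (rule measurable_PiM_single') (simp add: assms(1), simp)
  show "a \<in> M \<rightarrow>\<^sub>M PiM UNIV (\<lambda>_. count_space UNIV)"
    by (rule measurable_PiM_single') (rule assms(2), simp)
qed

context prob_space
begin

text \<open>
  The state at time \<open>n\<close> is a measurable function of the sources, and the law of the sources is
  determined by the law of the initial resources.
\<close>
lemma distr_state_cong:
  fixes X X' :: "'a \<Rightarrow> 'd::finite site \<Rightarrow> ennreal"
  assumes X: "X \<in> M \<rightarrow>\<^sub>M config_space" "independent_uniform_tie_breaks M X T"
    and X': "X' \<in> M \<rightarrow>\<^sub>M config_space" "independent_uniform_tie_breaks M X' T'"
    and eq: "distr M config_space X' = distr M config_space X"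
  shows "distr M state_space (\<lambda>\<omega>. (resource (T' \<omega>) (X' \<omega>) n, flow (T' \<omega>) (X' \<omega>) n)) =
    distr M state_space (\<lambda>\<omega>. (resource (T \<omega>) (X \<omega>) n, flow (T \<omega>) (X \<omega>) n))"
proof -
  let ?N = "config_space \<Otimes>\<^sub>M tie_space :: (('d site \<Rightarrow> ennreal) \<times> _) measure"
  let ?c = "\<lambda>s. fst s"
  let ?t = "\<lambda>s m x S. snd s (m, x, S)"
  define \<Phi> where "\<Phi> s = (resource (?t s) (?c s) n, flow (?t s) (?c s) n)"
    for s :: "('d site \<Rightarrow> ennreal) \<times> (nat \<times> 'd site \<times> 'd site set \<Rightarrow> 'd site)"
  have t: "(\<lambda>s. ?t s m x S) \<in> ?N \<rightarrow>\<^sub>M count_space UNIV" if "(m, x, S) \<in> tie_index" for m x S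
    by (rule measurable_compose[OF measurable_snd measurable_component_singleton]) (rule that)
  have c: "(\<lambda>s. ?c s x) \<in> borel_measurable ?N" for x
    by measurable
  have \<Phi>: "\<Phi> \<in> ?N \<rightarrow>\<^sub>M state_space"
    unfolding \<Phi>_def by (intro measurable_to_state measurable_resource measurable_flow c t)
  have \<Phi>_sources: "\<Phi> (sources c t) = (resource t c n, flow t c n)" for c t
  proof -
    have "?t (sources c t) m x S = t m x S" if "(m, x, S) \<in> tie_index" for m x S
      using that by (simp add: sources_def)
    then have "resource (?t (sources c t)) c n = resource t c n" "flow (?t (sources c t)) c n = flow t c n"
      by (auto intro: resource_cong flow_cong)
    then show ?thesis
      by (simp add: \<Phi>_def sources_def)
  qed
  have "distr M state_space (\<lambda>\<omega>. (resource (T \<omega>) (X \<omega>) n, flow (T \<omega>) (X \<omega>) n)) =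
      distr (distr M config_space X \<Otimes>\<^sub>M PiM tie_index (\<lambda>(n, x, S). measure_pmf (pmf_of_set S)))
        state_space \<Phi>"
    if "X \<in> M \<rightarrow>\<^sub>M config_space" "independent_uniform_tie_breaks M X T"
    for X :: "'a \<Rightarrow> 'd site \<Rightarrow> ennreal" and T
    unfolding distr_sources[OF that, symmetric]
    by (subst distr_distr[OF \<Phi> measurable_sources[OF that]]) (simp add: comp_def \<Phi>_sources)
  from this[OF X] this[OF X'] eq show ?thesis
    by simp
qed

lemma prob_state_cong:
  fixes X X' :: "'a \<Rightarrow> 'd::finite site \<Rightarrow> ennreal"
  assumes X: "X \<in> M \<rightarrow>\<^sub>M config_space" "independent_uniform_tie_breaks M X T"
    and X': "X' \<in> M \<rightarrow>\<^sub>M config_space" "independent_uniform_tie_breaks M X' T'"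
    and eq: "distr M config_space X' = distr M config_space X"
    and P: "Measurable.pred state_space (\<lambda>s. P (fst s) (snd s))"
  shows "\<P>(\<omega> in M. P (resource (T' \<omega>) (X' \<omega>) n) (flow (T' \<omega>) (X' \<omega>) n)) =
    \<P>(\<omega> in M. P (resource (T \<omega>) (X \<omega>) n) (flow (T \<omega>) (X \<omega>) n))"
proof -
  let ?A = "{s \<in> space state_space. P (fst s) (snd s)}"
  have "\<P>(\<omega> in M. P (resource (T \<omega>) (X \<omega>) n) (flow (T \<omega>) (X \<omega>) n)) =
      measure (distr M state_space (\<lambda>\<omega>. (resource (T \<omega>) (X \<omega>) n, flow (T \<omega>) (X \<omega>) n))) ?A"
    if X: "X \<in> M \<rightarrow>\<^sub>M config_space" "independent_uniform_tie_breaks M X T"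
    for X :: "'a \<Rightarrow> 'd site \<Rightarrow> ennreal" and T
  proof -
    have "(\<lambda>\<omega>. X \<omega> x) \<in> borel_measurable M" for x
      by (rule measurable_config_component[OF X(1)])
    then have "(\<lambda>\<omega>. (resource (T \<omega>) (X \<omega>) n, flow (T \<omega>) (X \<omega>) n)) \<in> M \<rightarrow>\<^sub>M state_space"
      by (intro measurable_to_state measurable_resource measurable_flow measurable_tie[OF X])
    moreover have "?A \<in> sets state_space"
      using P by (simp only: pred_def)
    moreover have "{\<omega> \<in> space M. P (resource (T \<omega>) (X \<omega>) n) (flow (T \<omega>) (X \<omega>) n)} =
        (\<lambda>\<omega>. (resource (T \<omega>) (X \<omega>) n, flow (T \<omega>) (X \<omega>) n)) -` ?A \<inter> space M"
      unfolding space_state_space by auto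
    ultimately show ?thesis
      by (simp only: measure_distr)
  qed
  note law = this
  show ?thesis
    unfolding law[OF X] law[OF X'] distr_state_cong[OF X X' eq] by (rule refl)
qed

end

locale clustering = prob_space M for M :: "'w measure" +
  fixes C0 :: "'w \<Rightarrow> 'd::finite site \<Rightarrow> ennreal"
    and T :: "'w \<Rightarrow> nat \<Rightarrow> 'd site \<Rightarrow> 'd site set \<Rightarrow> 'd site"
  assumes C0: "C0 \<in> M \<rightarrow>\<^sub>M config_space"
    and invariant: "translation_invariant M C0"
    and ties: "independent_uniform_tie_breaks M C0 T"
begin

abbreviation C :: "nat \<Rightarrow> 'w \<Rightarrow> 'd site \<Rightarrow> ennreal" where
  "C n \<omega> \<equiv> resource (T \<omega>) (C0 \<omega>) n"

abbreviation a :: "nat \<Rightarrow> 'w \<Rightarrow> 'd site \<Rightarrow> 'd site" where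
  "a n \<omega> \<equiv> flow (T \<omega>) (C0 \<omega>) n"

lemma measurable_C0 [measurable]: "(\<lambda>\<omega>. C0 \<omega> x) \<in> borel_measurable M"
  by (rule measurable_config_component[OF C0])

lemma measurable_C [measurable]: "(\<lambda>\<omega>. C n \<omega> x) \<in> borel_measurable M"
  by (intro measurable_resource measurable_tie[OF C0 ties] measurable_C0)

lemma measurable_a [measurable]: "(\<lambda>\<omega>. a n \<omega> x) \<in> M \<rightarrow>\<^sub>M count_space UNIV"
  by (intro measurable_flow measurable_tie[OF C0 ties] measurable_C0)

lemma measurable_state_at: "(\<lambda>\<omega>. (C n \<omega>, a n \<omega>)) \<in> M \<rightarrow>\<^sub>M state_space"
  by (intro measurable_to_state measurable_C measurable_a)

lemma pred_at_time:
  assumes "Measurable.pred state_space (\<lambda>s. P (fst s) (snd s))"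
  shows "Measurable.pred M (\<lambda>\<omega>. P (C n \<omega>) (a n \<omega>))"
  using measurable_compose[OF measurable_state_at[of n] assms] by (simp only: fst_conv snd_conv)

lemma AE_admissible: "AE \<omega> in M. \<forall>n. admissible (C n \<omega>) (a n \<omega>)"
  using AE_tie_in[OF C0 ties] by eventually_elim (auto intro!: admissible_flow)

lemma prob_translate:
  assumes P: "Measurable.pred state_space (\<lambda>s. P (fst s) (snd s))"
  shows "\<P>(\<omega> in M. P (\<lambda>x. C n \<omega> (x + z)) (\<lambda>x. a n \<omega> (x + z) - z)) =
    \<P>(\<omega> in M. P (C n \<omega>) (a n \<omega>))"
proof -
  let ?h = "\<lambda>c x. c (x + z) :: ennreal"
  have h: "?h \<in> config_space \<rightarrow>\<^sub>M config_space"
    by (intro measurable_PiM_single') auto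
  have "independent_uniform_tie_breaks M (\<lambda>\<omega>. ?h (C0 \<omega>)) (\<lambda>\<omega>. translate_ties z (T \<omega>))"
  proof (rule independent_uniform_tie_breaks_transform[OF C0 ties h,
        where r = "\<lambda>(n, x, S). (n, x + z, (\<lambda>y. y + z) ` S)" and f = "\<lambda>_ y. y - z"])
    show "inj_on (\<lambda>(n, x, S). (n, x + z, (\<lambda>y. y + z) ` S)) tie_index"
      by (auto simp: inj_on_def inj_image_eq_iff)
    show "(\<lambda>(n, x, S). (n, x + z, (\<lambda>y. y + z) ` S)) ` tie_index \<subseteq> tie_index"
      by (auto simp: tie_index_def nbhd_translate card_image)
    fix i :: "nat \<times> 'd site \<times> 'd site set"
    obtain n x S where i: "i = (n, x, S)" by (cases i)
    have "bij_betw (\<lambda>y. y - z) ((\<lambda>y. y + z) ` S) S"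
      by (rule bij_betwI[where g = "\<lambda>y. y + z"]) auto
    then show "bij_betw (\<lambda>y. y - z) (snd (snd (case i of (n, x, S) \<Rightarrow> (n, x + z, (\<lambda>y. y + z) ` S))))
        (snd (snd i))"
      by (simp add: i)
  qed (simp add: translate_ties_def)
  moreover have "distr M config_space (\<lambda>\<omega>. ?h (C0 \<omega>)) = distr M config_space C0"
    using invariant by (simp add: translation_invariant_def)
  moreover have "(\<lambda>\<omega>. ?h (C0 \<omega>)) \<in> M \<rightarrow>\<^sub>M config_space"
    using measurable_compose[OF C0 h] .
  ultimately have "\<P>(\<omega> in M. P (resource (translate_ties z (T \<omega>)) (?h (C0 \<omega>)) n)
        (flow (translate_ties z (T \<omega>)) (?h (C0 \<omega>)) n)) = \<P>(\<omega> in M. P (C n \<omega>) (a n \<omega>))"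
    by (intro prob_state_cong[OF C0 ties _ _ _ P])
  then show ?thesis
    by (simp only: resource_translate flow_translate)
qed

lemma prob_eq_expectation: "\<P>(\<omega> in M. P \<omega>) = expectation (\<lambda>\<omega>. of_bool (P \<omega>))"
proof -
  have "expectation (\<lambda>\<omega>. of_bool (P \<omega>)) = (\<integral>\<omega>. indicator {\<omega> \<in> space M. P \<omega>} \<omega> \<partial>M)"
    by (intro Bochner_Integration.integral_cong) auto
  also have "\<dots> = prob ({\<omega> \<in> space M. P \<omega>} \<inter> space M)"
    by (rule Bochner_Integration.integral_indicator)
  also have "{\<omega> \<in> space M. P \<omega>} \<inter> space M = {\<omega> \<in> space M. P \<omega>}"
    by auto
  finally show ?thesis
    by (rule sym)
qed

lemma integrable_of_bool:
  assumes [measurable]: "Measurable.pred M P"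
  shows "integrable M (\<lambda>\<omega>. of_bool (P \<omega>) :: real)"
  by (rule integrable_const_bound[where B = 1]) auto

lemma sum_prob_eq_expectation_card:
  assumes "finite I" and [measurable]: "\<And>i. i \<in> I \<Longrightarrow> Measurable.pred M (P i)"
  shows "(\<Sum>i\<in>I. \<P>(\<omega> in M. P i \<omega>)) = expectation (\<lambda>\<omega>. real (card {i \<in> I. P i \<omega>}))"
    and "integrable M (\<lambda>\<omega>. real (card {i \<in> I. P i \<omega>}))"
proof -
  have eq: "real (card {i \<in> I. P i \<omega>}) = (\<Sum>i\<in>I. of_bool (P i \<omega>))" for \<omega>
    using assms(1) by (simp add: Int_def)
  show "(\<Sum>i\<in>I. \<P>(\<omega> in M. P i \<omega>)) = expectation (\<lambda>\<omega>. real (card {i \<in> I. P i \<omega>}))"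
    unfolding eq
    by (subst Bochner_Integration.integral_sum) (auto simp: prob_eq_expectation intro!: integrable_of_bool)
  show "integrable M (\<lambda>\<omega>. real (card {i \<in> I. P i \<omega>}))"
    unfolding eq by (auto intro!: integrable_of_bool)
qed

text \<open>
  Every occupied vertex with property \<open>Q\<close> sends mass \<open>1\<close> to the vertex that it chooses. The expected mass sent
  from \<open>x\<close> to \<open>y\<close> equals the expected mass sent from the reflection \<open>2x - y\<close> of \<open>y\<close> to \<open>x\<close>, by
  translation invariance, and the reflection permutes the neighbourhood of \<open>x\<close>. So the expected
  mass sent equals the expected mass received.
\<close>
lemma mass_transport:
  fixes Q :: "('d site \<Rightarrow> ennreal) \<Rightarrow> ('d site \<Rightarrow> 'd site) \<Rightarrow> 'd site \<Rightarrow> bool"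
  assumes Q: "\<And>x. Measurable.pred state_space (\<lambda>s. Q (fst s) (snd s) x)"
    and equiv: "\<And>C a x z. Q (\<lambda>x. C (x + z)) (\<lambda>x. a (x + z) - z) x \<longleftrightarrow> Q C a (x + z)"
  defines "received \<equiv> \<lambda>n \<omega> x. {y \<in> senders (C n \<omega>) (a n \<omega>) x. Q (C n \<omega>) (a n \<omega>) y}"
  shows "\<P>(\<omega> in M. 0 < C n \<omega> x \<and> Q (C n \<omega>) (a n \<omega>) x) = expectation (\<lambda>\<omega>. real (card (received n \<omega> x)))"
    and "integrable M (\<lambda>\<omega>. real (card (received n \<omega> x)))"
proof -
  define E where "E C a x y \<longleftrightarrow> 0 < C x \<and> Q C a x \<and> a x = y"
    for C a and x y :: "'d site"
  have E_state: "Measurable.pred state_space (\<lambda>s. E (fst s) (snd s) x y)" for x y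
    unfolding E_def using Q by measurable
  have "Measurable.pred M (\<lambda>\<omega>. Q (C n \<omega>) (a n \<omega>) x)"
    by (rule pred_at_time[OF Q])
  moreover have "Measurable.pred M (\<lambda>\<omega>. 0 < C n \<omega> x)"
    by measurable
  ultimately have sends: "Measurable.pred M (\<lambda>\<omega>. 0 < C n \<omega> x \<and> Q (C n \<omega>) (a n \<omega>) x)"
    by (rule pred_intros_logic(3)[rotated])
  have E: "Measurable.pred M (\<lambda>\<omega>. E (C n \<omega>) (a n \<omega>) x y)" for x y
    by (rule pred_at_time[OF E_state])
  have received: "received n \<omega> x = {y \<in> nbhd x. E (C n \<omega>) (a n \<omega>) y x}" for \<omega>
    by (auto simp: received_def senders_def E_def)
  have "\<P>(\<omega> in M. 0 < C n \<omega> x \<and> Q (C n \<omega>) (a n \<omega>) x) =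
      expectation (\<lambda>\<omega>. of_bool (0 < C n \<omega> x \<and> Q (C n \<omega>) (a n \<omega>) x))"
    by (rule prob_eq_expectation)
  also have "\<dots> = expectation (\<lambda>\<omega>. real (card {y \<in> nbhd x. E (C n \<omega>) (a n \<omega>) x y}))"
  proof (rule integral_cong_AE)
    show "AE \<omega> in M. of_bool (0 < C n \<omega> x \<and> Q (C n \<omega>) (a n \<omega>) x) =
        real (card {y \<in> nbhd x. E (C n \<omega>) (a n \<omega>) x y})"
      using AE_admissible
    proof eventually_elim
      case (elim \<omega>)
      then have "{y \<in> nbhd x. E (C n \<omega>) (a n \<omega>) x y} =
          (if 0 < C n \<omega> x \<and> Q (C n \<omega>) (a n \<omega>) x then {a n \<omega> x} else {})"
        using admissible_in_nbhd by (auto simp: E_def)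
      then show ?case
        by simp
    qed
    show "(\<lambda>\<omega>. real (card {y \<in> nbhd x. E (C n \<omega>) (a n \<omega>) x y})) \<in> borel_measurable M"
      by (intro borel_measurable_integrable sum_prob_eq_expectation_card finite_nbhd E)
  qed (rule borel_measurable_integrable[OF integrable_of_bool[OF sends]])
  also have "\<dots> = (\<Sum>y\<in>nbhd x. \<P>(\<omega> in M. E (C n \<omega>) (a n \<omega>) x y))"
    by (intro sum_prob_eq_expectation_card(1)[symmetric] finite_nbhd E)
  also have "\<dots> = (\<Sum>y\<in>nbhd x. \<P>(\<omega> in M. E (C n \<omega>) (a n \<omega>) (x + x - y) x))"
  proof (intro sum.cong refl)
    fix y
    have "E (\<lambda>v. C (v + (x - y))) (\<lambda>v. a (v + (x - y)) - (x - y)) x y \<longleftrightarrow> E C a (x + x - y) x" for C a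
    proof -
      have "x + (x - y) = x + x - y"
        by (rule add_diff_eq)
      moreover have "u - (x - y) = y \<longleftrightarrow> u = x" for u
        by (simp add: diff_eq_eq)
      ultimately show ?thesis
        unfolding E_def equiv by (simp only:)
    qed
    then show "\<P>(\<omega> in M. E (C n \<omega>) (a n \<omega>) x y) = \<P>(\<omega> in M. E (C n \<omega>) (a n \<omega>) (x + x - y) x)"
      using prob_translate[OF E_state[of x y], of n "x - y"] by (simp only:)
  qed
  also have "\<dots> = (\<Sum>y\<in>nbhd x. \<P>(\<omega> in M. E (C n \<omega>) (a n \<omega>) y x))"
    by (rule sum.reindex_bij_witness[where i = "\<lambda>y. x + x - y" and j = "\<lambda>y. x + x - y"])
       (simp_all only: nbhd_reflect diff_diff_eq2 add_diff_cancel_left')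
  also have "\<dots> = expectation (\<lambda>\<omega>. real (card (received n \<omega> x)))"
    unfolding received by (intro sum_prob_eq_expectation_card finite_nbhd E)
  finally show "\<P>(\<omega> in M. 0 < C n \<omega> x \<and> Q (C n \<omega>) (a n \<omega>) x) =
      expectation (\<lambda>\<omega>. real (card (received n \<omega> x)))" .
  show "integrable M (\<lambda>\<omega>. real (card (received n \<omega> x)))"
    unfolding received by (intro sum_prob_eq_expectation_card finite_nbhd E)
qed

end

section \<open>Imbalance is summable\<close>

text \<open>
  From here on the resource at each time is treated as a random variable of its own.
\<close>
declare resource.simps(2) [simp del]

text \<open>
  Every ascending move crosses some rational threshold, but the probability of a crossing can be shown
  to tend to \<open>0\<close> only for finitely many thresholds at a time; hence the set \<open>F\<close>.
\<close>
definition crosses ::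
    "ennreal set \<Rightarrow> ('d::finite site \<Rightarrow> ennreal) \<Rightarrow> ('d site \<Rightarrow> 'd site) \<Rightarrow> 'd site \<Rightarrow> bool" where
  "crosses F C a x \<longleftrightarrow> (\<exists>c\<in>F. C x \<le> c \<and> c < C (a x))"

definition ascends ::
    "('d::finite site \<Rightarrow> ennreal) \<Rightarrow> ('d site \<Rightarrow> 'd site) \<Rightarrow> 'd site \<Rightarrow> bool" where
  "ascends C a x \<longleftrightarrow> 0 < C x \<and> C x < C (a x)"

lemma pred_crosses:
  assumes "\<And>x. (\<lambda>\<omega>. C \<omega> x) \<in> borel_measurable M"
    and "\<And>x. (\<lambda>\<omega>. a \<omega> x) \<in> M \<rightarrow>\<^sub>M count_space UNIV" and "finite F"
  shows "Measurable.pred M (\<lambda>\<omega>. crosses F (C \<omega>) (a \<omega>) x)"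
proof -
  note assms(1)[measurable] measurable_comp_target[OF assms(1,2), measurable]
  have "Measurable.pred M (\<lambda>\<omega>. C \<omega> x \<le> c \<and> c < C \<omega> (a \<omega> x))" for c
    by measurable
  then show ?thesis
    unfolding crosses_def by (intro pred_intros_finite(4) assms(3))
qed

context clustering
begin

lemma measurable_C_target [measurable]: "(\<lambda>\<omega>. C n \<omega> (a n \<omega> x)) \<in> borel_measurable M"
  by (rule measurable_comp_target[OF measurable_C measurable_a])

lemma pred_imbalanced_at [measurable]: "Measurable.pred M (\<lambda>\<omega>. imbalanced (C n \<omega>) (a n \<omega>) x)"
  by (intro pred_imbalanced measurable_C measurable_a)

lemma pred_tied_at [measurable]: "Measurable.pred M (\<lambda>\<omega>. tied (C n \<omega>) x)"
  by (intro pred_tied measurable_C)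

lemma pred_ascends_at [measurable]: "Measurable.pred M (\<lambda>\<omega>. ascends (C n \<omega>) (a n \<omega>) x)"
  unfolding ascends_def by measurable

abbreviation imbalance :: "nat \<Rightarrow> 'd site \<Rightarrow> real" where
  "imbalance n x \<equiv> \<P>(\<omega> in M. imbalanced (C n \<omega>) (a n \<omega>) x)"

text \<open>
  With \<open>k\<close> the number of senders to \<open>x\<close>, the claim is the expectation of the pointwise inequality
  \<open>[imbalanced] + 2 [k > 0] \<le> [C x > 0] + k\<close>, because \<open>k\<close> has the same expectation as \<open>[C x > 0]\<close>.
\<close>
lemma imbalance_le:
  "imbalance n x + 2 * \<P>(\<omega> in M. 0 < C (Suc n) \<omega> x) \<le> 2 * \<P>(\<omega> in M. 0 < C n \<omega> x)"
proof -
  have int: "integrable M (\<lambda>\<omega>. real (card (senders (C n \<omega>) (a n \<omega>) x)))"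
    and mass: "\<P>(\<omega> in M. 0 < C n \<omega> x) = expectation (\<lambda>\<omega>. real (card (senders (C n \<omega>) (a n \<omega>) x)))"
    using mass_transport[where Q = "\<lambda>_ _ _. True"] by simp_all
  have [measurable]: "Measurable.pred M (\<lambda>\<omega>. 0 < C n \<omega> x)" for n
    by measurable
  have "expectation (\<lambda>\<omega>. of_bool (imbalanced (C n \<omega>) (a n \<omega>) x) + 2 * of_bool (0 < C (Suc n) \<omega> x)) \<le>
      expectation (\<lambda>\<omega>. of_bool (0 < C n \<omega> x) + real (card (senders (C n \<omega>) (a n \<omega>) x)))"
  proof (rule integral_mono_AE)
    show "AE \<omega> in M. of_bool (imbalanced (C n \<omega>) (a n \<omega>) x) + 2 * of_bool (0 < C (Suc n) \<omega> x) \<le>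
        of_bool (0 < C n \<omega> x) + real (card (senders (C n \<omega>) (a n \<omega>) x))"
      using AE_admissible
    proof eventually_elim
      case (elim \<omega>)
      let ?S = "senders (C n \<omega>) (a n \<omega>) x"
      show ?case
      proof (cases "?S = {}")
        case True
        then show ?thesis
          unfolding resource_Suc_flow transfer_pos_iff by (simp add: imbalanced_def)
      next
        case False
        then obtain y where "y \<in> ?S"
          by blast
        then have "0 < C n \<omega> x"
          using elim senders_pos by blast
        moreover have "card ?S \<ge> 1"
          using False finite_senders[of "C n \<omega>" "a n \<omega>" x] by (simp add: Suc_le_eq card_gt_0_iff)
        ultimately show ?thesis
          by (auto simp: imbalanced_def)
      qed
    qed
  qed (intro Bochner_Integration.integrable_add integrable_mult_right integrable_of_bool int; measurable)+
  then show ?thesis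
    using int by (simp add: prob_eq_expectation[symmetric] mass[symmetric] integrable_of_bool)
qed

lemma summable_imbalance: "summable (\<lambda>n. imbalance n x)"
proof (rule summableI_nonneg_bounded)
  let ?p = "\<lambda>n. \<P>(\<omega> in M. 0 < C n \<omega> x)"
  have sum: "(\<Sum>k<n. imbalance k x) \<le> 2 * ?p 0 - 2 * ?p n" for n
  proof (induction n)
    case (Suc n)
    then show ?case
      using imbalance_le[of n x] by simp
  qed simp
  show "(\<Sum>k<n. imbalance k x) \<le> 2" for n
    using sum[of n] prob_le_1[of "{\<omega> \<in> space M. 0 < C 0 \<omega> x}"]
      measure_nonneg[of M "{\<omega> \<in> space M. 0 < C n \<omega> x}"] by linarith
qed simp

section \<open>Ascending moves become improbable\<close>

text \<open>
  Occupied vertices whose choice lies above \<open>c\<close> are those above \<open>c\<close> and those crossing \<open>c\<close>. By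
  mass transport they are as frequent as senders to vertices above \<open>c\<close>, and such a vertex
  has exactly one sender unless it is imbalanced.
\<close>
lemma prob_crosses_level_le:
  "\<P>(\<omega> in M. 0 < C n \<omega> x \<and> crosses {c} (C n \<omega>) (a n \<omega>) x) \<le> real (card (nbhd x)) * imbalance n x"
proof -
  have "(\<lambda>s. fst s (snd s y)) \<in> borel_measurable state_space" for y :: "'d site"
    by (rule measurable_comp_target[OF measurable_state])
  then have Q: "Measurable.pred state_space (\<lambda>s. c < fst s (snd s y))" for y :: "'d site"
    by measurable
  let ?R = "\<lambda>\<omega>. {y \<in> senders (C n \<omega>) (a n \<omega>) x. c < C n \<omega> (a n \<omega> y)}"
  note mass = mass_transport[where Q = "\<lambda>C a y. c < C (a y)", OF Q, where n = n and x = x, simplified]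
  have [measurable]: "Measurable.pred M (\<lambda>\<omega>. c < C n \<omega> x)"
      "Measurable.pred M (\<lambda>\<omega>. 0 < C n \<omega> x \<and> crosses {c} (C n \<omega>) (a n \<omega>) x)"
    unfolding crosses_def by measurable
  have "expectation (\<lambda>\<omega>. of_bool (0 < C n \<omega> x \<and> crosses {c} (C n \<omega>) (a n \<omega>) x) + of_bool (c < C n \<omega> x) :: real) \<le>
      expectation (\<lambda>\<omega>. of_bool (0 < C n \<omega> x \<and> c < C n \<omega> (a n \<omega> x)))"
  proof (rule integral_mono_AE)
    show "AE \<omega> in M. of_bool (0 < C n \<omega> x \<and> crosses {c} (C n \<omega>) (a n \<omega>) x) + of_bool (c < C n \<omega> x) \<le>
        (of_bool (0 < C n \<omega> x \<and> c < C n \<omega> (a n \<omega> x)) :: real)"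
      using AE_admissible
    proof eventually_elim
      case (elim \<omega>)
      then have "C n \<omega> x \<le> C n \<omega> (a n \<omega> x)"
        using admissible_le by blast
      then show ?case
        by (cases "c < C n \<omega> x") (auto simp: crosses_def intro: le_less_trans[OF zero_le])
    qed
  qed (auto intro!: integrable_of_bool)
  also have "\<dots> = expectation (\<lambda>\<omega>. real (card (?R \<omega>)))"
    using mass(1) by (simp add: prob_eq_expectation)
  also have "\<dots> \<le> expectation (\<lambda>\<omega>. of_bool (c < C n \<omega> x) +
      real (card (nbhd x)) * of_bool (imbalanced (C n \<omega>) (a n \<omega>) x))"
  proof (rule integral_mono)
    fix \<omega>
    let ?S = "senders (C n \<omega>) (a n \<omega>) x"
    show "real (card (?R \<omega>)) \<le> of_bool (c < C n \<omega> x) +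
        real (card (nbhd x)) * of_bool (imbalanced (C n \<omega>) (a n \<omega>) x)"
    proof (cases "c < C n \<omega> x")
      case True
      have "card (?R \<omega>) \<le> card ?S" "card ?S \<le> card (nbhd x)"
        by (auto intro!: card_mono finite_senders finite_nbhd simp: senders_def)
      moreover have "imbalanced (C n \<omega>) (a n \<omega>) x \<or> card ?S = 1"
        using True by (auto simp: imbalanced_def intro: le_less_trans[OF zero_le])
      ultimately show ?thesis
        using True by auto
    next
      case False
      then have "?R \<omega> = {}"
        by (auto simp: senders_def)
      then show ?thesis
        by (simp only: card.empty) simp
    qed
  qed (intro Bochner_Integration.integrable_add integrable_mult_right integrable_of_bool mass(2); measurable)+
  finally show ?thesis
    by (simp add: prob_eq_expectation[symmetric] integrable_of_bool)
qed

lemma prob_crosses_le: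
  assumes "finite F"
  shows "\<P>(\<omega> in M. 0 < C n \<omega> x \<and> crosses F (C n \<omega>) (a n \<omega>) x) \<le>
    card F * (real (card (nbhd x)) * imbalance n x)"
proof -
  let ?A = "\<lambda>c. {\<omega> \<in> space M. 0 < C n \<omega> x \<and> crosses {c} (C n \<omega>) (a n \<omega>) x}"
  have A: "?A c \<in> sets M" for c
    unfolding crosses_def by measurable
  have "{\<omega> \<in> space M. 0 < C n \<omega> x \<and> crosses F (C n \<omega>) (a n \<omega>) x} = (\<Union>c\<in>F. ?A c)"
    by (auto simp: crosses_def)
  then have "\<P>(\<omega> in M. 0 < C n \<omega> x \<and> crosses F (C n \<omega>) (a n \<omega>) x) \<le> (\<Sum>c\<in>F. prob (?A c))"
    using finite_measure_subadditive_finite[OF assms, of ?A] A by (simp add: image_subset_iff)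
  also have "\<dots> \<le> (\<Sum>c\<in>F. real (card (nbhd x)) * imbalance n x)"
    by (intro sum_mono prob_crosses_level_le)
  finally show ?thesis
    by simp
qed

text \<open>
  This bounds the expected number of crossings at senders to \<open>x\<close> that are not continued by a crossing at
  \<open>x\<close>: an imbalance in the neighbourhood must be responsible, and at most \<open>card (nbhd x)\<close> senders are
  affected by it.
\<close>
definition crossing_loss :: "nat \<Rightarrow> 'd site \<Rightarrow> real" where
  "crossing_loss n x = real (card (nbhd x)) * (\<Sum>u\<in>nbhd x. imbalance n u)"

lemma crossing_loss_nonneg: "crossing_loss n x \<ge> 0"
  by (simp add: crossing_loss_def sum_nonneg)

lemma summable_crossing_loss: "summable (\<lambda>n. crossing_loss n x)"
  unfolding crossing_loss_def by (intro summable_mult summable_sum summable_imbalance)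

text \<open>
  A vertex that crosses a threshold of \<open>F\<close> sends this crossing to its choice \<open>x\<close>. Unless there is an
  imbalance in the neighbourhood of \<open>x\<close>, the vertex \<open>x\<close> receives at most one crossing and, having received
  one, crosses the same threshold in the next step.
\<close>
lemma prob_crosses_Suc:
  assumes F: "finite F"
  shows "\<P>(\<omega> in M. 0 < C n \<omega> x \<and> crosses F (C n \<omega>) (a n \<omega>) x) \<le>
    \<P>(\<omega> in M. 0 < C (Suc n) \<omega> x \<and> crosses F (C (Suc n) \<omega>) (a (Suc n) \<omega>) x) + crossing_loss n x"
proof -
  have Q: "Measurable.pred state_space (\<lambda>s. crosses F (fst s) (snd s) y)" for y :: "'d site"
    by (intro pred_crosses measurable_state F)
  let ?R = "\<lambda>\<omega>. {y \<in> senders (C n \<omega>) (a n \<omega>) x. crosses F (C n \<omega>) (a n \<omega>) y}"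
  have equiv: "crosses F (\<lambda>x. C (x + z)) (\<lambda>x. a (x + z) - z) y \<longleftrightarrow> crosses F C a (y + z)"
    for C a and y z :: "'d site"
    by (simp add: crosses_def)
  note mass = mass_transport[OF Q equiv, where n = n and x = x]
  have pos: "Measurable.pred M (\<lambda>\<omega>. 0 < C m \<omega> x)" for m
    by measurable
  have cross: "Measurable.pred M (\<lambda>\<omega>. crosses F (C m \<omega>) (a m \<omega>) x)" for m
    by (rule pred_crosses[OF measurable_C measurable_a F])
  have meas: "Measurable.pred M (\<lambda>\<omega>. 0 < C m \<omega> x \<and> crosses F (C m \<omega>) (a m \<omega>) x)" for m
    by (rule pred_intros_logic(3)[OF pos[of m] cross[of m]])
  have "expectation (\<lambda>\<omega>. real (card (?R \<omega>))) \<le>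
      expectation (\<lambda>\<omega>. of_bool (0 < C (Suc n) \<omega> x \<and> crosses F (C (Suc n) \<omega>) (a (Suc n) \<omega>) x) +
        real (card (nbhd x)) * (\<Sum>u\<in>nbhd x. of_bool (imbalanced (C n \<omega>) (a n \<omega>) u)))"
  proof (rule integral_mono_AE)
    show "AE \<omega> in M. real (card (?R \<omega>)) \<le>
        of_bool (0 < C (Suc n) \<omega> x \<and> crosses F (C (Suc n) \<omega>) (a (Suc n) \<omega>) x) +
        real (card (nbhd x)) * (\<Sum>u\<in>nbhd x. of_bool (imbalanced (C n \<omega>) (a n \<omega>) u))"
      using AE_admissible
    proof eventually_elim
      case (elim \<omega>)
      let ?S = "senders (C n \<omega>) (a n \<omega>) x"
      consider "?R \<omega> = {}" | u where "u \<in> nbhd x" "imbalanced (C n \<omega>) (a n \<omega>) u"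
        | y where "y \<in> ?R \<omega>" "\<forall>u\<in>nbhd x. \<not> imbalanced (C n \<omega>) (a n \<omega>) u"
        by blast
      then show ?case
      proof cases
        case 1
        then show ?thesis
          unfolding 1 by (simp add: sum_nonneg)
      next
        case 2
        have "card (?R \<omega>) \<le> card (nbhd x)"
          by (auto intro!: card_mono finite_nbhd simp: senders_def)
        also have "real (card (nbhd x)) * 1 \<le>
            real (card (nbhd x)) * (\<Sum>u\<in>nbhd x. of_bool (imbalanced (C n \<omega>) (a n \<omega>) u))"
          using member_le_sum[OF 2(1), of "\<lambda>u. of_bool (imbalanced (C n \<omega>) (a n \<omega>) u) :: real"] 2(2)
          by (intro mult_left_mono) (simp_all add: finite_nbhd)
        finally show ?thesis
          by simp
      next
        case 3
        then have y: "y \<in> ?S" and "crosses F (C n \<omega>) (a n \<omega>) y"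
          by auto
        then obtain c where c: "c \<in> F" "C n \<omega> y \<le> c" "c < C n \<omega> x"
          by (auto simp: crosses_def senders_def)
        have adm: "admissible (C n \<omega>) (a n \<omega>)"
            "admissible (transfer (a n \<omega>) (C n \<omega>)) (a (Suc n) \<omega>)"
          using elim resource_Suc_flow by metis+
        have bal: "\<not> imbalanced (C n \<omega>) (a n \<omega>) x" "\<not> imbalanced (C n \<omega>) (a n \<omega>) (a n \<omega> x)"
          using 3(2) admissible_in_nbhd[OF adm(1), of x] by auto
        have "C (Suc n) \<omega> x = C n \<omega> y" "C n \<omega> x \<le> C (Suc n) \<omega> (a (Suc n) \<omega> x)"
          unfolding resource_Suc_flow using balanced_step[OF adm y bal] by auto
        then have "0 < C (Suc n) \<omega> x \<and> crosses F (C (Suc n) \<omega>) (a (Suc n) \<omega>) x"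
          using c y by (auto simp: crosses_def senders_def intro!: bexI[of _ c])
        moreover have "?S = {y}"
          using balanced_sender[OF adm(1) bal(1) y] by simp
        then have "card (?R \<omega>) \<le> 1"
          using card_mono[of ?S "?R \<omega>"] by auto
        ultimately show ?thesis
          by (simp add: sum_nonneg add_increasing2)
      qed
    qed
  qed (intro Bochner_Integration.integrable_add integrable_mult_right integrable_of_bool
      Bochner_Integration.integrable_sum mass(2) meas pred_imbalanced_at)+
  then show ?thesis
    by (simp add: mass(1) prob_eq_expectation[symmetric] integrable_of_bool meas crossing_loss_def)
qed

text \<open>
  Iterate the previous estimate up to a late time \<open>m + n\<close>, at which the probability of a crossing
  tends to \<open>0\<close> for the fixed finite set \<open>F\<close>. The resulting bound is the same for all \<open>F\<close>.
\<close>
lemma prob_crosses_le_tail: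
  assumes F: "finite F"
  shows "\<P>(\<omega> in M. 0 < C n \<omega> x \<and> crosses F (C n \<omega>) (a n \<omega>) x) \<le> (\<Sum>k. crossing_loss (k + n) x)"
proof -
  let ?q = "\<lambda>n. \<P>(\<omega> in M. 0 < C n \<omega> x \<and> crosses F (C n \<omega>) (a n \<omega>) x)"
  have sum: "summable (\<lambda>k. crossing_loss (k + n) x)"
    using summable_crossing_loss by (rule summable_ignore_initial_segment)
  have le: "?q n \<le> ?q (m + n) + (\<Sum>k<m. crossing_loss (k + n) x)" for m
  proof (induction m)
    case (Suc m)
    then show ?case
      using prob_crosses_Suc[OF F, of "m + n" x] by simp
  qed simp
  have le_tail: "?q n \<le> ?q (m + n) + (\<Sum>k. crossing_loss (k + n) x)" for m
  proof -
    have "(\<Sum>k<m. crossing_loss (k + n) x) \<le> (\<Sum>k. crossing_loss (k + n) x)"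
      by (rule sum_le_suminf[OF sum]) (simp_all add: crossing_loss_nonneg)
    then show ?thesis
      using le[of m] by linarith
  qed
  have "(\<lambda>m. card F * (real (card (nbhd x)) * imbalance m x)) \<longlonglongrightarrow> real (card F) * (real (card (nbhd x)) * 0)"
    by (intro tendsto_intros summable_LIMSEQ_zero summable_imbalance)
  then have "?q \<longlonglongrightarrow> 0"
    by (intro tendsto_sandwich[OF _ _ tendsto_const, of _ ?q])
       (auto intro!: always_eventually prob_crosses_le[OF F])
  then have "(\<lambda>m. ?q (m + n) + (\<Sum>k. crossing_loss (k + n) x)) \<longlonglongrightarrow> 0 + (\<Sum>k. crossing_loss (k + n) x)"
    by (intro tendsto_intros LIMSEQ_ignore_initial_segment)
  then show ?thesis
    using le_tail by (intro LIMSEQ_le_const[of _ _ "?q n"]) auto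
qed

lemma prob_ascends_le_tail: "\<P>(\<omega> in M. ascends (C n \<omega>) (a n \<omega>) x) \<le> (\<Sum>k. crossing_loss (k + n) x)"
proof -
  \<comment> \<open>Every strict inequality between values is witnessed by a rational number, and \<open>F k\<close> is an
      exhaustion of the nonnegative rational numbers by finite sets.\<close>
  define F where "F k = (\<lambda>j. ennreal (real_of_rat (from_nat j))) ` {..<k}" for k
  let ?A = "\<lambda>k. {\<omega> \<in> space M. 0 < C n \<omega> x \<and> crosses (F k) (C n \<omega>) (a n \<omega>) x}"
  have "Measurable.pred M (\<lambda>\<omega>. crosses (F k) (C n \<omega>) (a n \<omega>) x)" for k
    by (intro pred_crosses measurable_C measurable_a) (simp add: F_def)
  then have "?A k \<in> sets M" for k
    by measurable
  moreover have "incseq ?A"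
    by (force simp: incseq_def crosses_def F_def)
  ultimately have "(\<lambda>k. prob (?A k)) \<longlonglongrightarrow> prob (\<Union>k. ?A k)"
    by (intro finite_Lim_measure_incseq) auto
  moreover have "(\<Union>k. ?A k) = {\<omega> \<in> space M. ascends (C n \<omega>) (a n \<omega>) x}"
  proof safe
    fix \<omega> assume "\<omega> \<in> space M" and asc: "ascends (C n \<omega>) (a n \<omega>) x"
    then obtain r where r: "C n \<omega> x < ennreal (real_of_rat r)" "ennreal (real_of_rat r) < C n \<omega> (a n \<omega> x)"
      using ennreal_rat_dense by (auto simp: ascends_def)
    have "ennreal (real_of_rat r) \<in> F (Suc (to_nat r))"
      by (force simp: F_def)
    then have "\<omega> \<in> ?A (Suc (to_nat r))"
      using r asc \<open>\<omega> \<in> space M\<close>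
      by (auto simp: crosses_def ascends_def intro!: bexI[of _ "ennreal (real_of_rat r)"])
    then show "\<omega> \<in> (\<Union>k. ?A k)"
      by blast
  qed (auto simp: crosses_def ascends_def)
  ultimately show ?thesis
    using prob_crosses_le_tail[of "F _"] by (intro LIMSEQ_le_const2[of "\<lambda>k. prob (?A k)"]) (auto simp: F_def)
qed

lemma prob_ascends_tendsto_0: "(\<lambda>n. \<P>(\<omega> in M. ascends (C n \<omega>) (a n \<omega>) x)) \<longlonglongrightarrow> 0"
proof -
  have "(\<lambda>n. (\<Sum>k. crossing_loss k x) - (\<Sum>k<n. crossing_loss k x)) \<longlonglongrightarrow> (\<Sum>k. crossing_loss k x) - (\<Sum>k. crossing_loss k x)"
    by (intro tendsto_intros summable_LIMSEQ summable_crossing_loss)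
  then have "(\<lambda>n. \<Sum>k. crossing_loss (k + n) x) \<longlonglongrightarrow> 0"
    by (simp add: suminf_minus_initial_segment[OF summable_crossing_loss])
  then show ?thesis
    by (intro tendsto_sandwich[OF _ _ tendsto_const, of _ "\<lambda>n. \<P>(\<omega> in M. ascends (C n \<omega>) (a n \<omega>) x)"])
       (auto intro!: always_eventually prob_ascends_le_tail)
qed

section \<open>Ties are summable\<close>

text \<open>
  The tie break at time \<open>n\<close> and vertex \<open>y\<close> has no influence on the resources at time \<open>n\<close> or on the
  other choices at that time. Exchanging its outcome \<open>u\<close> with some other maximizer thus redirects \<open>y\<close>
  alone, and it makes or has made \<open>u\<close> imbalanced. Each of the two cases has probability at most
  that of imbalance, because the exchange preserves the law.
\<close>
lemma prob_tied_towards_le: "\<P>(\<omega> in M. tied (C n \<omega>) y \<and> a n \<omega> y = u) \<le> 2 * imbalance n u"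
proof -
  define w where "w S = (SOME v. v \<in> S \<and> v \<noteq> u)" for S :: "'d site set"
  define f where "f = (\<lambda>(m, x, S). if m = n \<and> x = y \<and> u \<in> S then Transposition.transpose u (w S) else id)"
  define T' where "T' \<omega> m x S = f (m, x, S) (T \<omega> m x S)" for \<omega> m x S
  have w: "w S \<in> S" "w S \<noteq> u" if S: "(m, x, S) \<in> tie_index" for m x and S
  proof -
    have "\<exists>v. v \<in> S \<and> v \<noteq> u"
    proof (rule ccontr)
      assume "\<not> ?thesis"
      then have "card S \<le> card {u}"
        by (intro card_mono) auto
      then show False
        using S by (simp add: tie_index_def)
    qed
    then have "w S \<in> S \<and> w S \<noteq> u"
      unfolding w_def by (rule someI_ex)
    then show "w S \<in> S" "w S \<noteq> u"
      by auto
  qed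
  have ties': "independent_uniform_tie_breaks M C0 T'"
  proof (rule independent_uniform_tie_breaks_transform[OF C0 ties, where h = "\<lambda>c. c" and r = "\<lambda>i. i" and f = f])
    fix i :: "nat \<times> 'd site \<times> 'd site set" assume i: "i \<in> tie_index"
    obtain m x S where i_eq: "i = (m, x, S)" by (cases i)
    show "bij_betw (f i) (snd (snd i)) (snd (snd i))"
      using w[of m x S] i by (auto simp: f_def i_eq)
  qed (auto simp: T'_def)
  \<comment> \<open>The resources at time \<open>n\<close> depend on the tie breaks of earlier times only.\<close>
  have resource': "resource (T' \<omega>) (C0 \<omega>) n = C n \<omega>" for \<omega>
    by (rule resource_cong) (simp add: T'_def f_def)
  have others: "flow (T' \<omega>) (C0 \<omega>) n x = a n \<omega> x" if "x \<noteq> y" for \<omega> x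
    unfolding flow_def resource' using that by (intro target_cong) (simp add: T'_def f_def)
  have redirect: "flow (T' \<omega>) (C0 \<omega>) n y \<noteq> a n \<omega> y"
    if tied: "tied (C n \<omega>) y" "a n \<omega> y = u" and u: "u \<in> maximizers (C n \<omega>) y" for \<omega>
  proof -
    let ?S = "maximizers (C n \<omega>) y"
    have "T \<omega> n y ?S = u"
      using flow_tied[OF tied(1)] tied(2) by simp
    moreover have "flow (T' \<omega>) (C0 \<omega>) n y = T' \<omega> n y ?S"
      using flow_tied[of "T' \<omega>" "C0 \<omega>" n y] tied(1) by (simp add: resource')
    ultimately have "flow (T' \<omega>) (C0 \<omega>) n y = w ?S"
      using u by (simp add: T'_def f_def)
    then show ?thesis
      using w(2)[OF tied_in_tie_index[OF tied(1)]] tied(2) by simp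
  qed
  let ?imb = "\<lambda>t \<omega>. imbalanced (resource (t \<omega>) (C0 \<omega>) n) (flow (t \<omega>) (C0 \<omega>) n) u"
  have imb: "{\<omega> \<in> space M. ?imb T \<omega>} \<in> sets M"
    by measurable
  have imb': "{\<omega> \<in> space M. ?imb T' \<omega>} \<in> sets M"
  proof -
    have "(\<lambda>\<omega>. resource (T' \<omega>) (C0 \<omega>) n x) \<in> borel_measurable M" for x
      by (intro measurable_resource measurable_tie[OF C0 ties'] measurable_C0)
    moreover have "(\<lambda>\<omega>. flow (T' \<omega>) (C0 \<omega>) n x) \<in> M \<rightarrow>\<^sub>M count_space UNIV" for x
      by (intro measurable_flow measurable_tie[OF C0 ties'] measurable_C0)
    ultimately have "Measurable.pred M (?imb T')"
      by (rule pred_imbalanced)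
    then show ?thesis
      by (simp add: pred_def)
  qed
  have "\<P>(\<omega> in M. tied (C n \<omega>) y \<and> a n \<omega> y = u) \<le>
      prob ({\<omega> \<in> space M. ?imb T \<omega>} \<union> {\<omega> \<in> space M. ?imb T' \<omega>})"
  proof (rule finite_measure_mono_AE)
    show "AE \<omega> in M. \<omega> \<in> {\<omega> \<in> space M. tied (C n \<omega>) y \<and> a n \<omega> y = u} \<longrightarrow>
        \<omega> \<in> {\<omega> \<in> space M. ?imb T \<omega>} \<union> {\<omega> \<in> space M. ?imb T' \<omega>}"
      using AE_admissible
    proof eventually_elim
      case (elim \<omega>)
      have "?imb T \<omega> \<or> ?imb T' \<omega>" if tied: "tied (C n \<omega>) y" "a n \<omega> y = u"
      proof -
        have adm: "admissible (C n \<omega>) (a n \<omega>)" and pos: "C n \<omega> y > 0"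
          using elim tied by (auto simp: tied_def)
        then have "u \<in> maximizers (C n \<omega>) y"
          using tied(2) by (auto simp: admissible_def)
        from imbalanced_if_redirected[OF adm pos others redirect[OF tied this]]
        show ?thesis
          unfolding resource' tied(2) .
      qed
      then show ?case
        by auto
    qed
    show "{\<omega> \<in> space M. ?imb T \<omega>} \<union> {\<omega> \<in> space M. ?imb T' \<omega>} \<in> sets M"
      using imb imb' by (rule sets.Un)
  qed
  also have "\<dots> \<le> imbalance n u + \<P>(\<omega> in M. ?imb T' \<omega>)"
    by (rule measure_Un_le[OF imb imb'])
  also have "\<P>(\<omega> in M. ?imb T' \<omega>) = imbalance n u"
    by (intro prob_state_cong[OF C0 ties C0 ties' refl] pred_imbalanced measurable_state)
  finally show ?thesis
    by simp
qed

lemma summable_tied: "summable (\<lambda>n. \<P>(\<omega> in M. tied (C n \<omega>) y))"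
proof (rule summable_comparison_test')
  show "summable (\<lambda>n. \<Sum>u\<in>nbhd y. 2 * imbalance n u)"
    by (intro summable_sum summable_mult summable_imbalance)
  fix n
  let ?A = "\<lambda>u. {\<omega> \<in> space M. tied (C n \<omega>) y \<and> a n \<omega> y = u}"
  have A: "?A u \<in> sets M" for u
    by measurable
  have "\<P>(\<omega> in M. tied (C n \<omega>) y) \<le> prob (\<Union>u\<in>nbhd y. ?A u)"
  proof (rule finite_measure_mono_AE)
    show "AE \<omega> in M. \<omega> \<in> {\<omega> \<in> space M. tied (C n \<omega>) y} \<longrightarrow> \<omega> \<in> (\<Union>u\<in>nbhd y. ?A u)"
      using AE_admissible by eventually_elim (auto intro: admissible_in_nbhd)
    show "(\<Union>u\<in>nbhd y. ?A u) \<in> sets M"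
      using A by (intro sets.finite_UN finite_nbhd) auto
  qed
  also have "\<dots> \<le> (\<Sum>u\<in>nbhd y. prob (?A u))"
    using A by (intro finite_measure_subadditive_finite finite_nbhd) auto
  also have "\<dots> \<le> (\<Sum>u\<in>nbhd y. 2 * imbalance n u)"
    by (intro sum_mono prob_tied_towards_le)
  finally show "norm (\<P>(\<omega> in M. tied (C n \<omega>) y)) \<le> (\<Sum>u\<in>nbhd y. 2 * imbalance n u)"
    by simp
qed

section \<open>The flow stops\<close>

lemma AE_eventually_regular:
  "AE \<omega> in M. \<forall>\<^sub>F n in sequentially. \<forall>u\<in>nbhd x. \<not> imbalanced (C n \<omega>) (a n \<omega>) u \<and> \<not> tied (C n \<omega>) u"
proof -
  have "AE \<omega> in M. \<forall>\<^sub>F n in sequentially. \<not> imbalanced (C n \<omega>) (a n \<omega>) u \<and> \<not> tied (C n \<omega>) u" for u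
  proof -
    have "AE \<omega> in M. \<forall>\<^sub>F n in sequentially. \<omega> \<in> space M - {\<omega> \<in> space M. imbalanced (C n \<omega>) (a n \<omega>) u}"
      by (rule borel_cantelli_AE1) (simp_all add: summable_imbalance emeasure_eq_measure)
    moreover have "AE \<omega> in M. \<forall>\<^sub>F n in sequentially. \<omega> \<in> space M - {\<omega> \<in> space M. tied (C n \<omega>) u}"
      by (rule borel_cantelli_AE1) (simp_all add: summable_tied emeasure_eq_measure)
    ultimately show ?thesis
    proof eventually_elim
      case (elim \<omega>)
      then show ?case
        by eventually_elim simp
    qed
  qed
  then have "AE \<omega> in M. \<forall>u\<in>nbhd x. \<forall>\<^sub>F n in sequentially. \<not> imbalanced (C n \<omega>) (a n \<omega>) u \<and> \<not> tied (C n \<omega>) u"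
    by (intro AE_finite_allI finite_nbhd)
  then show ?thesis
    by (simp add: eventually_ball_finite_distrib finite_nbhd)
qed

text \<open>
  Ascending at all times from \<open>k\<close> on is at most as probable as ascending at any single late time.
\<close>
lemma AE_not_ascending_forever: "AE \<omega> in M. \<forall>k. \<exists>n\<ge>k. \<not> ascends (C n \<omega>) (a n \<omega>) x"
proof (rule AE_all_countable[THEN iffD2], rule allI)
  fix k
  let ?G = "{\<omega> \<in> space M. \<forall>n\<ge>k. ascends (C n \<omega>) (a n \<omega>) x}"
  have "?G \<in> sets M"
    by measurable
  have "prob ?G \<le> \<P>(\<omega> in M. ascends (C n \<omega>) (a n \<omega>) x)" if "n \<ge> k" for n
    using that by (intro finite_measure_mono) auto
  then have "prob ?G \<le> 0"
    using prob_ascends_tendsto_0[of x] by (intro LIMSEQ_le_const) auto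
  then have "prob ?G = 0"
    using measure_nonneg[of M ?G] by simp
  then have "AE \<omega> in M. \<omega> \<notin> ?G"
    using prob_eq_0[OF \<open>?G \<in> sets M\<close>] by simp
  then show "AE \<omega> in M. \<exists>n\<ge>k. \<not> ascends (C n \<omega>) (a n \<omega>) x"
    using AE_space by eventually_elim auto
qed

lemma AE_flow_stops: "AE \<omega> in M. \<exists>N. \<forall>n\<ge>N. a n \<omega> x = x"
  using AE_admissible AE_eventually_regular[of x] AE_not_ascending_forever[of x]
proof eventually_elim
  case (elim \<omega>)
  then obtain N where N: "\<forall>n\<ge>N. \<forall>u\<in>nbhd x. \<not> imbalanced (C n \<omega>) (a n \<omega>) u \<and> \<not> tied (C n \<omega>) u"
    unfolding eventually_sequentially by blast
  have ascend: "ascends (C (Suc n) \<omega>) (a (Suc n) \<omega>) x" if "n \<ge> N" "a n \<omega> x \<noteq> x" for n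
  proof -
    have adm: "admissible (C n \<omega>) (a n \<omega>)" "admissible (transfer (a n \<omega>) (C n \<omega>)) (a (Suc n) \<omega>)"
      using elim(1) resource_Suc_flow by metis+
    show ?thesis
      unfolding ascends_def resource_Suc_flow
      using moving_persists[OF adm _ that(2)] N that(1) by blast
  qed
  show ?case
  proof (rule ccontr)
    assume "\<not> ?case"
    then obtain n where n: "n \<ge> N" "a n \<omega> x \<noteq> x"
      by blast
    have "ascends (C (Suc m) \<omega>) (a (Suc m) \<omega>) x" if "m \<ge> n" for m
      using that
    proof (induction m rule: dec_induct)
      case base
      then show ?case
        using ascend n by blast
    next
      case (step m)
      from step.IH have "a (Suc m) \<omega> x \<noteq> x"
        by (auto simp: ascends_def)
      then show ?case
        using ascend[of "Suc m"] n(1) step.hyps by simp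
    qed
    then have "\<forall>m\<ge>Suc n. ascends (C m \<omega>) (a m \<omega>) x"
      by (metis Suc_le_D Suc_le_mono)
    then show False
      using elim(3) by blast
  qed
qed

end

theorem theorem1p1:
  fixes M :: "'w measure"
    and C0 :: "'w \<Rightarrow> int ^ 'd::finite \<Rightarrow> ennreal"
    and T :: "'w \<Rightarrow> nat \<Rightarrow> int ^ 'd \<Rightarrow> (int ^ 'd) set \<Rightarrow> int ^ 'd"
    and x :: "int ^ 'd"
  assumes "prob_space M"
    and "C0 \<in> M \<rightarrow>\<^sub>M config_space"
    and "translation_invariant M C0"
    and "independent_uniform_tie_breaks M C0 T"
  shows "\<P>(\<omega> in M. \<exists>N. \<forall>n\<ge>N. flow (T \<omega>) (C0 \<omega>) n x = x) = 1"
proof -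
  interpret clustering M C0 T
    by (intro clustering.intro clustering_axioms.intro assms)
  have "{\<omega> \<in> space M. \<exists>N. \<forall>n\<ge>N. a n \<omega> x = x} \<in> sets M"
    by measurable
  then show ?thesis
    by (rule prob_Collect_eq_1[THEN iffD2, OF _ AE_flow_stops])
qed

end
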